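(* Let $Q$, $A$, $B$, $C_Q$, $c(t)$ be as in the context, fix $c_1,c_2\in C_Q$, and for $a,b\in\mathbb{R}^2$ let $\widehat{\Phi}_{a,b}=\widehat{\Phi}^{c_1,c_2}_{a,b}$ be the function on $\mathbb{H}$ defined in the context. Then for all $a,b\in\mathbb{R}^2$: \begin{equation*} \widehat{\Phi}_{a+\lambda,b+\mu} = e^{2\pi iB(a,\mu)} \widehat{\Phi}_{a,b} \quad \text{for all}\ \lambda\in\mathbb{Z}^2,\ \mu\in A^{-1} \mathbb{Z}^2,\qquad \widehat{\Phi}_{-a,-b} = \widehat{\Phi}_{a,b}, \end{equation*} and for all $\tau\in\mathbb{H}$ \begin{equation*} \widehat{\Phi}_{a,b} (\tau+1) = e^{-2\pi iQ(a)-\pi iB(A^{-1} A^*,a)}\ \widehat{\Phi}_{a,a+b+\frac{1}{2}A^{-1} A^*}(\tau),\qquad \widehat{\Phi}_{a,b} (-1/\tau) = \frac{e^{2\pi i B(a,b)}}{\sqrt{-\det A}} \sum_{p\in A^{-1} \mathbb{Z}^2 \bmod{\mathbb{Z}^2}} \widehat{\Phi}_{-b+p,a}(\tau), \end{equation*} where $A^*\in\mathbb{Z}^2$ is the vector of diagonal entries of $A$.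
   Context: $A$ is a symmetric $2\times 2$ matrix with integer entries such that the quadratic form $Q(\nu)=\frac12\nu^tA\nu$ on $\mathbb{R}^2$ has signature $(1,1)$; $B(\nu,\mu)=\nu^tA\mu$. The set $\{c\in\mathbb{R}^2: Q(c)=-1\}$ has two components; $C_Q$ denotes a fixed one of them. Choose $P\in\mathrm{GL}_2(\mathbb{R})$ with $A=P^t\begin{pmatrix}0&1\\1&0\end{pmatrix}P$ and with sign chosen so that $P^{-1}\binom{1}{-1}\in C_Q$. For $t\in\mathbb{R}$ put $c(t)=P^{-1}\binom{e^t}{-e^{-t}}$ and $c^\perp(t)=P^{-1}\binom{e^t}{e^{-t}}$; $t\mapsto c(t)$ parametrizes $C_Q$. For $c_i\in C_Q$ let $t_i$ be defined by $c(t_i)=c_i$. For $\tau=x+iy\in\mathbb{H}$, $q=e^{2\pi i\tau}$, and $a,b\in\mathbb{R}^2$, \begin{equation*} \widehat{\Phi}^{c_1,c_2}_{a,b}(\tau)=y^{1/2}\sum_{\nu\in a+\mathbb{Z}^2} q^{Q(\nu)}e^{2\pi iB(\nu,b)}\int_{t_1}^{t_2}e^{-\pi yB(\nu,c(t))^2}\,dt \end{equation*} (this series converges absolutely). *)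

theory Defs
  imports "HOL-Analysis.Analysis"
begin

definition quad_form :: "real^'n^'n \<Rightarrow> real^'n \<Rightarrow> real" where
  "quad_form A v = (1/2) * (v \<bullet> (A *v v))"

definition bil_form :: "real^'n^'n \<Rightarrow> real^'n \<Rightarrow> real^'n \<Rightarrow> real" where
  "bil_form A v w = v \<bullet> (A *v w)"

text \<open>In some linear coordinates the form is diagonal, with \<open>p\<close> positive and \<open>r\<close> negative
  diagonal entries; by Sylvester's law of inertia \<open>p\<close> and \<open>r\<close> do not depend on the coordinates.\<close>

definition has_signature :: "(real^'n \<Rightarrow> real) \<Rightarrow> nat \<Rightarrow> nat \<Rightarrow> bool" where
  "has_signature Q p r \<longleftrightarrow>
     (\<exists>(S :: real^'n^'n) (d :: real^'n). invertible S \<and>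
        (\<forall>x. Q (S *v x) = (\<Sum>i\<in>UNIV. d $ i * (x $ i)\<^sup>2)) \<and>
        card {i. d $ i > 0} = p \<and> card {i. d $ i < 0} = r)"

definition int_lattice :: "(real^'n) set" where
  "int_lattice = {v. \<forall>i. v $ i \<in> \<int>}"

definition dual_lattice :: "real^'n^'n \<Rightarrow> (real^'n) set" where
  "dual_lattice A = (\<lambda>v. matrix_inv A *v v) ` int_lattice"

definition diag_vec :: "real^'n^'n \<Rightarrow> real^'n" where
  "diag_vec A = (\<chi> i. A $ i $ i)"

definition coset_reps :: "('a::ab_group_add) set \<Rightarrow> 'a set \<Rightarrow> 'a set \<Rightarrow> bool" where
  "coset_reps L M R \<longleftrightarrow> R \<subseteq> L \<and> (\<forall>p\<in>L. \<exists>!r. r \<in> R \<and> p - r \<in> M)"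

lemma coset_reps_exists:
  fixes A :: "real^'n^'n"
  shows "\<exists>R. coset_reps (dual_lattice A) int_lattice R"
proof -
  let ?f = "\<lambda>p. SOME r. r \<in> dual_lattice A \<and> p - r \<in> (int_lattice :: (real^'n) set)"
  have zero: "(0 :: real^'n) \<in> int_lattice"
    by (simp add: int_lattice_def)
  have diff: "x - y \<in> int_lattice" if "x \<in> int_lattice" "y \<in> int_lattice" for x y :: "real^'n"
    using that by (simp add: int_lattice_def)
  have f: "?f p \<in> dual_lattice A \<and> p - ?f p \<in> int_lattice" if "p \<in> dual_lattice A" for p
    by (rule someI[of _ p]) (use that zero in simp)
  have eq: "?f p = ?f p'" if "p - p' \<in> int_lattice" for p p'
  proof -
    have "p - r \<in> int_lattice \<longleftrightarrow> p' - r \<in> int_lattice" for r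
      using diff[of "p - r" "p - p'"] diff[of "p' - r" "p' - p"] diff[OF zero that] that
      by (auto simp: algebra_simps)
    then show ?thesis by simp
  qed
  have "coset_reps (dual_lattice A) int_lattice (?f ` dual_lattice A)"
    unfolding coset_reps_def
  proof (intro conjI ballI ex_ex1I)
    show "?f ` dual_lattice A \<subseteq> dual_lattice A" using f by blast
    fix p assume p: "p \<in> dual_lattice A"
    show "\<exists>r. r \<in> ?f ` dual_lattice A \<and> p - r \<in> int_lattice" using f[OF p] p by blast
    have *: "r = ?f p" if "r \<in> ?f ` dual_lattice A" "p - r \<in> int_lattice" for r
    proof -
      obtain s where s: "s \<in> dual_lattice A" "r = ?f s" using \<open>r \<in> ?f ` dual_lattice A\<close> by blast
      have "s - r \<in> int_lattice" using f[OF s(1)] s(2) by simp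
      from diff[OF this that(2)] have "s - p \<in> int_lattice" by simp
      from eq[OF this] s(2) show ?thesis by simp
    qed
    fix r r' assume "r \<in> ?f ` dual_lattice A \<and> p - r \<in> int_lattice"
      "r' \<in> ?f ` dual_lattice A \<and> p - r' \<in> int_lattice"
    then show "r = r'" using *[of r] *[of r'] by (elim conjE) (simp only:)
  qed
  then show ?thesis by blast
qed

definition hyp_matrix :: "real^2^2" where
  "hyp_matrix = vector [vector [0, 1], vector [1, 0]]"

definition c_curve :: "real^2^2 \<Rightarrow> real \<Rightarrow> real^2" where
  "c_curve P t = matrix_inv P *v vector [exp t, - exp (- t)]"

definition t_param :: "real^2^2 \<Rightarrow> real^2 \<Rightarrow> real" where
  "t_param P c = (THE t. c_curve P t = c)"

lemma quad_form_hyp: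
  assumes "A = transpose P ** hyp_matrix ** P"
  shows "quad_form A v = (P *v v) $ 1 * (P *v v) $ 2"
proof -
  have "v \<bullet> (A *v v) = (P *v v) \<bullet> (hyp_matrix *v (P *v v))"
    unfolding assms
    by (simp add: matrix_vector_mul_assoc[symmetric] inner_commute[of v] dot_lmul_matrix)
      (rule inner_commute)
  also have "\<dots> = 2 * ((P *v v) $ 1 * (P *v v) $ 2)"
    by (simp add: hyp_matrix_def inner_vec_def sum_2 matrix_vector_mult_def[of "vector _"])
  finally show ?thesis by (simp add: quad_form_def)
qed

text \<open>The definite description in \<open>t_param\<close> is well defined: \<open>c_curve P\<close> parametrizes the
  component of \<open>{v. quad_form A v = -1}\<close> through \<open>c_curve P 0\<close>.\<close>

lemma c_curve_t_param:
  assumes "invertible P" and A: "A = transpose P ** hyp_matrix ** P"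
    and C: "C \<in> components {v. quad_form A v = -1}"
    and "matrix_inv P *v vector [1, -1] \<in> C" and "c \<in> C"
  shows "c_curve P (t_param P c) = c"
proof -
  let ?u = "\<lambda>v. (P *v v) $ 1"
  have inv: "P *v (matrix_inv P *v w) = w" "matrix_inv P *v (P *v w) = w" for w
    using someI_ex[OF \<open>invertible P\<close>[unfolded invertible_def]]
    by (simp_all add: matrix_vector_mul_assoc matrix_inv_def)
  have sub: "?u v * (P *v v) $ 2 = -1" if "v \<in> C" for v
    using in_components_subset[OF C] that quad_form_hyp[OF A] by auto
  have conn: "connected (?u ` C)"
    using in_components_connected[OF C]
    by (intro connected_continuous_image)
      (auto simp: matrix_vector_mult_def intro!: continuous_intros)
  have "1 \<in> ?u ` C"
    by (rule image_eqI[OF _ assms(4)]) (simp add: inv(1))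
  moreover have "0 \<notin> ?u ` C" using sub by force
  ultimately have "?u c > 0"
    using connectedD_interval[OF conn, of "?u c" 1 0] \<open>c \<in> C\<close> by force
  then have "P *v c = vector [exp (ln (?u c)), - exp (- ln (?u c))]"
    using sub[OF \<open>c \<in> C\<close>] by (simp add: vec_eq_iff forall_2 exp_minus field_simps)
  then have ex: "c_curve P (ln (?u c)) = c"
    unfolding c_curve_def by (metis inv(2))
  have "s = ln (?u c)" if "c_curve P s = c" for s
    unfolding that[symmetric] c_curve_def by (simp add: inv(1))
  then show ?thesis
    unfolding t_param_def by (rule theI[of "\<lambda>t. c_curve P t = c", OF ex])
qed

text \<open>Here \<open>q\<^sup>Q\<close> with \<open>q = exp (2\<pi>i\<tau>)\<close> means \<open>exp (2\<pi>i\<tau>Q)\<close>, and the interval integral is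
  oriented, so \<open>t_param P c1 > t_param P c2\<close> is allowed.\<close>

definition Phi_hat ::
  "real^2^2 \<Rightarrow> real^2^2 \<Rightarrow> real^2 \<Rightarrow> real^2 \<Rightarrow> real^2 \<Rightarrow> real^2 \<Rightarrow> complex \<Rightarrow> complex" where
  "Phi_hat A P c1 c2 a b \<tau> =
     of_real (sqrt (Im \<tau>)) *
     (\<Sum>\<^sub>\<infinity>v\<in>(\<lambda>n. a + n) ` int_lattice.
        exp (2 * of_real pi * \<i> * \<tau> * of_real (quad_form A v)) *
        exp (2 * of_real pi * \<i> * of_real (bil_form A v b)) *
        of_real (LBINT t=ereal (t_param P c1)..ereal (t_param P c2).
          exp (- pi * Im \<tau> * (bil_form A v (c_curve P t))\<^sup>2)))"

end

theory Submission
  imports Defs "HOL-Complex_Analysis.Conformal_Mappings" "HOL-Probability.Characteristic_Functions"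
begin

text \<open>
  For fixed \<open>t\<close> put \<open>w = (e\<^sup>-\<^sup>t (P\<nu>)\<^sub>1, e\<^sup>t (P\<nu>)\<^sub>2)\<close>. Then \<open>Q(\<nu>) = w\<^sub>1 w\<^sub>2\<close> and \<open>B(\<nu>, c(t)) = w\<^sub>2 - w\<^sub>1\<close>, so the
  summand is the Gaussian \<open>exp (2\<pi>i x w\<^sub>1 w\<^sub>2 - \<pi> y (w\<^sub>1\<^sup>2 + w\<^sub>2\<^sup>2))\<close> times a character, and the parameter
  \<open>t\<close> only replaces \<open>P\<close> by another matrix with the same determinant that represents the same form.
  The series converges uniformly for \<open>t\<close> in a compact interval, hence sum and integral may be
  exchanged. The first three transformation laws hold term by term. The last one is Poisson
  summation for each \<open>t\<close>: the Gaussian at \<open>-1/\<tau>\<close> has as Fourier transform \<open>\<bar>\<tau>\<bar> / \<bar>det P\<bar>\<close> times the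
  Gaussian at \<open>\<tau>\<close>, and the sum over the dual lattice splits into cosets of \<open>\<int>\<^sup>2\<close>.

  Poisson summation in the plane is obtained by applying the inversion formula for the Jacobi theta
  series, with complex modulus and argument, in each variable in turn. That formula is the pointwise
  convergence of a Fourier series for real parameters and extends by analytic continuation.
\<close>

section \<open>Gaussian sums and theta series\<close>

text \<open>Obstacle: Q is indefinite, so |q^Q| grows where Q < 0, and the two factors of a summand
  cannot be transformed separately. Only the product of q^Q with exp(-pi y B(v,c(t))^2) is a
  Gaussian whose quadratic form has positive definite real part. Hence both factors are merged into
  \<open>theta_kernel\<close> and everything happens under the t-integral. A Gaussian with complex
  quadratic form brings in complex square roots. For signature (1,1) the determinant of this form at
  -1/tau is the positive real number det(P)^2/|tau|^2, so the two principal roots left by the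
  one-variable steps multiply to a positive number and no phase survives. The remaining |tau| is
  cancelled by y^(1/2), because Im(-1/tau) = Im tau/|tau|^2, and |det P| = sqrt(-det A) because det
  A = -(det P)^2. The sum over cosets is an ordinary finite sum, which by convention is 0 over an
  infinite set; finiteness of every set of representatives is therefore part of the proof.\<close>

lemma summable_on_exp_minus_abs_int: "(\<lambda>n::int. exp (- \<bar>real_of_int n\<bar>)) summable_on UNIV"
proof -
  let ?f = "\<lambda>n::int. exp (- \<bar>real_of_int n\<bar>)"
  have "(\<lambda>n::nat. exp (- real n)) summable_on UNIV"
  proof (rule summable_nonneg_imp_summable_on)
    have "(\<lambda>n::nat. exp (- real n)) = (\<lambda>n. exp (-1) ^ n)"
      by (simp add: exp_of_nat_mult[symmetric])
    then show "summable (\<lambda>n::nat. exp (- real n))"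
      by (simp add: summable_geometric)
  qed simp
  then have "(?f \<circ> int) summable_on UNIV" "(?f \<circ> (\<lambda>n. - int n)) summable_on UNIV"
    by (simp_all add: o_def)
  then have "?f summable_on range int" "?f summable_on range (\<lambda>n. - int n)"
    by (simp_all add: summable_on_reindex inj_on_def)
  then have "?f summable_on (range int \<union> range (\<lambda>n. - int n))"
    by (rule summable_on_union)
  also have "range int \<union> range (\<lambda>n. - int n) = UNIV"
  proof -
    have "n \<in> range int \<union> range (\<lambda>n. - int n)" for n
      by (cases n rule: int_cases2) auto
    then show ?thesis by blast
  qed
  finally show ?thesis .
qed

lemma summable_on_gauss_int:
  fixes \<delta> B :: real
  assumes "\<delta> > 0"
  shows "(\<lambda>n::int. exp (- \<delta> * (real_of_int n)\<^sup>2 + B * \<bar>real_of_int n\<bar>)) summable_on UNIV"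
proof (rule summable_on_comparison_test)
  show "(\<lambda>n::int. exp ((B + 1)\<^sup>2 / (4 * \<delta>)) * exp (- \<bar>real_of_int n\<bar>)) summable_on UNIV"
    by (intro summable_on_cmult_right summable_on_exp_minus_abs_int)
  fix n :: int
  define u where "u = \<bar>real_of_int n\<bar>"
  \<comment> \<open>Completing the square with \<open>B + 1\<close> instead of \<open>B\<close>
    leaves a linear decay of slope 1 to compare with.\<close>
  have "0 \<le> (2 * \<delta> * u - (B + 1))\<^sup>2 / (4 * \<delta>)" using assms by simp
  also have "\<dots> = \<delta> * u\<^sup>2 - (B + 1) * u + (B + 1)\<^sup>2 / (4 * \<delta>)"
    using assms by (simp add: field_simps power2_eq_square)
  finally have "- \<delta> * u\<^sup>2 + B * u \<le> (B + 1)\<^sup>2 / (4 * \<delta>) - u"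
    by (simp add: algebra_simps)
  then show "exp (- \<delta> * (real_of_int n)\<^sup>2 + B * \<bar>real_of_int n\<bar>) \<le>
      exp ((B + 1)\<^sup>2 / (4 * \<delta>)) * exp (- \<bar>real_of_int n\<bar>)"
    unfolding exp_add[symmetric] by (simp add: u_def)
qed simp

lemma summable_on_gauss_shift:
  fixes \<delta> a :: real
  assumes "\<delta> > 0"
  shows "(\<lambda>n::int. exp (- \<delta> * (real_of_int n + a)\<^sup>2)) summable_on UNIV"
proof (rule summable_on_comparison_test)
  show "(\<lambda>n::int. exp (- \<delta> * (real_of_int n)\<^sup>2 + (2 * \<delta> * \<bar>a\<bar>) * \<bar>real_of_int n\<bar>)) summable_on UNIV"
    by (rule summable_on_gauss_int[OF assms])
  fix n :: int
  have "- \<delta> * (n + a)\<^sup>2 = - \<delta> * n\<^sup>2 + 2 * \<delta> * (- (a * n)) - \<delta> * a\<^sup>2" 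
    by (simp add: power2_eq_square algebra_simps)
  also have "\<dots> \<le> - \<delta> * n\<^sup>2 + 2 * \<delta> * (\<bar>a\<bar> * \<bar>n\<bar>) - 0"
  proof -
    have "2 * \<delta> * (- (a * n)) \<le> 2 * \<delta> * (\<bar>a\<bar> * \<bar>n\<bar>)"
      using assms abs_ge_minus_self[of "a * n"] by (intro mult_left_mono) (auto simp: abs_mult)
    moreover have "0 \<le> \<delta> * a\<^sup>2" using assms by simp
    ultimately show ?thesis by linarith
  qed
  finally show "exp (- \<delta> * (real_of_int n + a)\<^sup>2) \<le>
      exp (- \<delta> * (real_of_int n)\<^sup>2 + (2 * \<delta> * \<bar>a\<bar>) * \<bar>real_of_int n\<bar>)"
    by (simp add: mult.assoc)
qed simp

lemma summable_on_gauss_plane: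
  fixes A B C a b :: real
  assumes A: "A > 0" and D: "B\<^sup>2 < A * C"
  shows "(\<lambda>(m::int, n::int). exp (- (A * (real_of_int m + a)\<^sup>2
      + 2 * B * (real_of_int m + a) * (real_of_int n + b) + C * (real_of_int n + b)\<^sup>2)))
    summable_on UNIV"
proof -
  have C: "C > 0"
    using A D zero_less_mult_pos[of A C] zero_le_power2[of B] by linarith
  \<comment> \<open>Determinant over trace of the symmetric matrix with entries \<open>A\<close>,
    \<open>B\<close>, \<open>C\<close>: for positive eigenvalues, their product divided by their sum
    is below the smaller one. The form thus dominates a diagonal one, whose Gaussian splits into a
    product.\<close>
  define \<epsilon> where "\<epsilon> = (A * C - B\<^sup>2) / (A + C)"
  have e: "\<epsilon> > 0" using A C D by (simp add: \<epsilon>_def)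
  have pd: "\<epsilon> * x\<^sup>2 + \<epsilon> * y\<^sup>2 \<le> A * x\<^sup>2 + 2 * B * x * y + C * y\<^sup>2" for x y
  proof -
    have e': "(A + C) * \<epsilon> = A * C - B\<^sup>2" using A C by (simp add: \<epsilon>_def)
    \<comment> \<open>By Cayley-Hamilton, |Mv|^2 = tr(M) (v . Mv) - det(M) |v|^2 for this symmetric
      matrix M.\<close>
    have "0 \<le> (A * x + B * y)\<^sup>2 + (B * x + C * y)\<^sup>2" by simp
    also have "\<dots> = (A + C) * (A * x\<^sup>2 + 2 * B * x * y + C * y\<^sup>2) - (A * C - B\<^sup>2) * (x\<^sup>2 + y\<^sup>2)"
      by algebra
    also have "\<dots> = (A + C) * (A * x\<^sup>2 + 2 * B * x * y + C * y\<^sup>2 - (\<epsilon> * x\<^sup>2 + \<epsilon> * y\<^sup>2))"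
      unfolding e'[symmetric] by algebra
    finally show ?thesis using A C by (simp add: zero_le_mult_iff)
  qed
  let ?g = "\<lambda>a (n::int). exp (- \<epsilon> * (real_of_int n + a)\<^sup>2)"
  have "(\<lambda>(m, n). ?g a m * ?g b n) summable_on (UNIV \<times> UNIV)"
  proof (rule summable_on_SigmaI)
    show "((\<lambda>n. case (m, n) of (m, n) \<Rightarrow> ?g a m * ?g b n) has_sum (?g a m * infsum (?g b) UNIV)) UNIV" for m
      using summable_on_gauss_shift[OF e, of b] by (auto intro!: has_sum_cmult_right)
    show "(\<lambda>m. ?g a m * infsum (?g b) UNIV) summable_on UNIV"
      by (intro summable_on_cmult_left summable_on_gauss_shift e)
  qed auto
  then have *: "(\<lambda>(m, n). ?g a m * ?g b n) summable_on UNIV"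
    by simp
  show ?thesis
  proof (rule summable_on_comparison_test[OF *], goal_cases)
    case (1 z)
    show ?case
      using pd[of "fst z + a" "snd z + b"]
      unfolding case_prod_beta exp_add[symmetric] exp_le_cancel_iff by simp
  qed (simp add: case_prod_beta)
qed

text \<open>Jacobi's theta function theta_3 at argument \<open>w\<close> and modulus i
  \<open>s\<close>. With this normalization the upper half-plane becomes \<open>Re s > 0\<close>,
  where \<open>csqrt\<close> is holomorphic.\<close>

definition theta_series :: "complex \<Rightarrow> complex \<Rightarrow> complex" where
  "theta_series s w = (\<Sum>\<^sub>\<infinity>n::int. exp (- of_real pi * s * (of_int n)\<^sup>2 + 2 * of_real pi * \<i> * of_int n * w))"

text \<open>The bound depends on \<open>s\<close> and \<open>w\<close> only through
  \<open>\<delta>\<close> and \<open>B\<close>, so it serves as a majorant in the M-test, both for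
  holomorphy and for exchanging sum and integral.\<close>

lemma norm_theta_term_le:
  assumes "Re s \<ge> \<delta>" and "norm w \<le> B"
  shows "norm (exp (- of_real pi * s * (of_int n)\<^sup>2 + 2 * of_real pi * \<i> * of_int n * w))
    \<le> exp (- (pi * \<delta>) * (real_of_int n)\<^sup>2 + (2 * pi * B) * \<bar>real_of_int n\<bar>)"
proof -
  have "\<bar>n\<bar> * \<bar>Im w\<bar> \<le> \<bar>n\<bar> * B"
    using assms(2) abs_Im_le_cmod[of w] by (intro mult_left_mono) auto
  then have "- (n * Im w) \<le> \<bar>n\<bar> * B"
    using abs_ge_minus_self[of "n * Im w"] by (simp add: abs_mult)
  moreover have "\<delta> * (real_of_int n)\<^sup>2 \<le> Re s * (real_of_int n)\<^sup>2"
    using assms(1) by (intro mult_right_mono) auto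
  ultimately have "pi * (- (Re s * (real_of_int n)\<^sup>2) - 2 * (n * Im w)) \<le>
      pi * (- (\<delta> * (real_of_int n)\<^sup>2) + 2 * (\<bar>n\<bar> * B))"
    by (intro mult_left_mono) auto
  moreover have "Re (s * (of_int n)\<^sup>2) = Re s * (real_of_int n)\<^sup>2"
    by (simp add: power2_eq_square algebra_simps)
  ultimately show ?thesis
    by (simp add: algebra_simps)
qed

lemma theta_series_summable:
  assumes "Re s > 0"
  shows "(\<lambda>n::int. exp (- of_real pi * s * (of_int n)\<^sup>2 + 2 * of_real pi * \<i> * of_int n * w)) summable_on UNIV"
proof (rule abs_summable_summable)
  show "(\<lambda>n::int. norm (exp (- of_real pi * s * (of_int n)\<^sup>2 + 2 * of_real pi * \<i> * of_int n * w))) summable_on UNIV"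
    by (rule Infinite_Sum.abs_summable_on_comparison_test'[OF summable_on_gauss_int norm_theta_term_le[of "Re s" _ _ "norm w"]])
      (use assms in auto)
qed

text \<open>Composing with holomorphic \<open>S\<close> and \<open>W\<close> keeps everything in one
  complex variable, yet covers continuation in the modulus and in the argument. On a closed ball
  compactness bounds \<open>Re (S z)\<close> away from 0 and \<open>norm (W z)\<close> from above,
  which gives uniform convergence.\<close>

lemma theta_series_holomorphic:
  assumes U: "open U" and S: "S holomorphic_on U" and W: "W holomorphic_on U"
    and pos: "\<And>z. z \<in> U \<Longrightarrow> Re (S z) > 0"
  shows "(\<lambda>z. theta_series (S z) (W z)) holomorphic_on U"
proof -
  have "\<exists>r>0. (\<lambda>z. theta_series (S z) (W z)) holomorphic_on ball z0 r" if z0: "z0 \<in> U" for z0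
  proof -
    obtain r where r: "r > 0" "cball z0 r \<subseteq> U"
      using U z0 open_contains_cball by blast
    have cS: "continuous_on (cball z0 r) S" and cW: "continuous_on (cball z0 r) W"
      using S W r holomorphic_on_imp_continuous_on holomorphic_on_subset by blast+
    have "continuous_on (cball z0 r) (\<lambda>z. Re (S z))"
      by (intro continuous_intros cS)
    then obtain z1 where z1: "z1 \<in> cball z0 r" "\<And>z. z \<in> cball z0 r \<Longrightarrow> Re (S z1) \<le> Re (S z)"
      using continuous_attains_inf[of "cball z0 r" "\<lambda>z. Re (S z)"] r by auto
    have "continuous_on (cball z0 r) (\<lambda>z. norm (W z))"
      by (intro continuous_intros cW)
    then obtain z2 where z2: "\<And>z. z \<in> cball z0 r \<Longrightarrow> norm (W z) \<le> norm (W z2)"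
      using continuous_attains_sup[of "cball z0 r" "\<lambda>z. norm (W z)"] r by fastforce
    have d: "Re (S z1) > 0" using pos z1 r by auto
    let ?t = "\<lambda>(n::int) z. exp (- of_real pi * S z * (of_int n)\<^sup>2 + 2 * of_real pi * \<i> * of_int n * W z)"
    have ul: "uniform_limit (cball z0 r) (\<lambda>X z. \<Sum>n\<in>X. ?t n z) (\<lambda>z. theta_series (S z) (W z))
        (finite_subsets_at_top UNIV)"
      unfolding theta_series_def
    proof (rule Weierstrass_m_test_general)
      show "norm (?t n z) \<le> exp (- (pi * Re (S z1)) * (real_of_int n)\<^sup>2 + (2 * pi * norm (W z2)) * \<bar>real_of_int n\<bar>)"
        if "z \<in> cball z0 r" for n z
        using z1(2) z2 that by (intro norm_theta_term_le) auto
      show "(\<lambda>n::int. exp (- (pi * Re (S z1)) * (real_of_int n)\<^sup>2 + (2 * pi * norm (W z2)) * \<bar>real_of_int n\<bar>)) summable_on UNIV"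
        by (rule summable_on_gauss_int) (use d in simp)
    qed
    have hol: "(\<lambda>z. \<Sum>n\<in>X. ?t n z) holomorphic_on U" for X
      by (intro holomorphic_intros S W)
    have "(\<lambda>z. theta_series (S z) (W z)) holomorphic_on ball z0 r"
    proof (rule holomorphic_uniform_limit[OF _ ul])
      have "continuous_on (cball z0 r) (\<lambda>z. \<Sum>n\<in>X. ?t n z) \<and> (\<lambda>z. \<Sum>n\<in>X. ?t n z) holomorphic_on ball z0 r" for X
        using holomorphic_on_imp_continuous_on[OF holomorphic_on_subset[OF hol r(2)]]
          holomorphic_on_subset[OF hol, of "ball z0 r"] r(2) ball_subset_cball[of z0 r] by blast
      then show "\<forall>\<^sub>F X in finite_subsets_at_top UNIV.
          continuous_on (cball z0 r) (\<lambda>z. \<Sum>n\<in>X. ?t n z) \<and> (\<lambda>z. \<Sum>n\<in>X. ?t n z) holomorphic_on ball z0 r"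
        by simp
    qed simp_all
    then show ?thesis using r by blast
  qed
  then have "(\<lambda>z. theta_series (S z) (W z)) field_differentiable (at z)" if "z \<in> U" for z
    using that by (meson centre_in_ball holomorphic_on_imp_differentiable_at open_ball)
  then show ?thesis
    using field_differentiable_at_within holomorphic_on_def by blast
qed

section \<open>Poisson summation for Gaussians\<close>

text \<open>The majorant makes the finite partial sums converge uniformly along the net of finite
  subsets of \<open>X\<close>, and integration over a compact interval respects uniform limits. It
  is used for the translates of a Gaussian and again for the integral over t.\<close>

lemma has_sum_integral_interval:
  fixes f :: "'a \<Rightarrow> real \<Rightarrow> 'b::banach"
  assumes cont: "\<And>v. continuous_on {a..b} (f v)"
    and le: "\<And>v t. v \<in> X \<Longrightarrow> t \<in> {a..b} \<Longrightarrow> norm (f v t) \<le> M v"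
    and M: "M summable_on X"
  shows "((\<lambda>v. integral {a..b} (f v)) has_sum integral {a..b} (\<lambda>t. \<Sum>\<^sub>\<infinity>v\<in>X. f v t)) X"
proof -
  have ul: "uniform_limit {a..b} (\<lambda>Y t. \<Sum>v\<in>Y. f v t) (\<lambda>t. \<Sum>\<^sub>\<infinity>v\<in>X. f v t) (finite_subsets_at_top X)"
    by (rule Weierstrass_m_test_general[OF le M])
  have c: "continuous_on {a..b} (\<lambda>t. \<Sum>v\<in>Y. f v t)" for Y
    by (intro continuous_intros cont)
  obtain I J where I: "\<And>Y. ((\<lambda>t. \<Sum>v\<in>Y. f v t) has_integral I Y) {a..b}"
    and J: "((\<lambda>t. \<Sum>\<^sub>\<infinity>v\<in>X. f v t) has_integral J) {a..b}"
    and IJ: "(I \<longlongrightarrow> J) (finite_subsets_at_top X)"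
    by (rule uniform_limit_integral[OF ul c]) auto
  have "I Y = (\<Sum>v\<in>Y. integral {a..b} (f v))" for Y
  proof (cases "finite Y")
    case True
    then have "((\<lambda>t. \<Sum>v\<in>Y. f v t) has_integral (\<Sum>v\<in>Y. integral {a..b} (f v))) {a..b}"
      by (intro has_integral_sum) (auto intro!: integrable_integral integrable_continuous_real cont)
    with I show ?thesis by (blast intro: has_integral_unique)
  next
    case False
    \<comment> \<open>For infinite \<open>Y\<close> both finite-sum expressions are 0 by
      convention.\<close>
    then show ?thesis using I[of Y] by (simp add: has_integral_unique[OF _ has_integral_0])
  qed
  then have "I = (\<lambda>Y. \<Sum>v\<in>Y. integral {a..b} (f v))" by blast
  with IJ J show "((\<lambda>v. integral {a..b} (f v)) has_sum integral {a..b} (\<lambda>t. \<Sum>\<^sub>\<infinity>v\<in>X. f v t)) X"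
    unfolding has_sum_def by (simp add: integral_unique)
qed

section \<open>Pointwise convergence of Fourier series\<close>

lemma has_sum_int_LIMSEQ:
  assumes "(f has_sum S) (UNIV :: int set)"
  shows "(\<lambda>N. \<Sum>k\<in>{- int N..int N}. f k) \<longlonglongrightarrow> S"
proof -
  \<comment> \<open>Symmetric intervals are cofinal among the finite sets of integers; only along
    them will the partial sums telescope to two terms.\<close>
  have "filterlim (\<lambda>N. {- int N..int N}) (finite_subsets_at_top UNIV) sequentially"
    unfolding filterlim_finite_subsets_at_top
  proof safe
    fix X :: "int set" assume X: "finite X"
    obtain B where B: "\<And>x. x \<in> X \<Longrightarrow> \<bar>x\<bar> \<le> B"
      using X by (meson finite_imageI finite_nat_set_iff_bounded_le finite_has_maximal Max_ge abs_le_iff image_eqI)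
    show "\<forall>\<^sub>F N in sequentially. finite {- int N..int N} \<and> X \<subseteq> {- int N..int N} \<and> {- int N..int N} \<subseteq> UNIV"
      using eventually_ge_at_top[of "nat B"]
    proof eventually_elim
      case (elim N)
      then show ?case using B by (fastforce simp: abs_le_iff)
    qed
  qed
  with assms show ?thesis
    unfolding has_sum_def by (rule filterlim_compose)
qed

lemma integral_exp_character:
  fixes k :: int
  shows "integral {-1/2..1/2} (\<lambda>x. exp (- 2 * of_real pi * \<i> * of_int k * of_real x)) = (if k = 0 then 1 else (0::complex))"
proof (cases "k = 0")
  case False
  define w :: complex where "w = - 2 * of_real pi * \<i> * of_int k"
  have w: "w \<noteq> 0" using False by (simp add: w_def)
  have "((\<lambda>x. exp (w * of_real x)) has_integral (exp (w * of_real (1/2)) / w - exp (w * of_real (-1/2)) / w)) {-1/2..1/2}"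
  proof (rule fundamental_theorem_of_calculus)
    fix x :: real
    have "((\<lambda>z. exp (w * z) / w) has_field_derivative exp (w * of_real x)) (at (of_real x))"
      using w by (auto intro!: derivative_eq_intros)
    then show "((\<lambda>x. exp (w * of_real x) / w) has_vector_derivative exp (w * of_real x)) (at x within {-1/2..1/2})"
      by (rule has_vector_derivative_real_field)
  qed simp
  moreover have "exp (w * of_real (1/2)) = exp (w * of_real (-1/2))"
  proof -
    have "exp (w * of_real (1/2)) = exp (w * of_real (-1/2) + w)"
      by (rule arg_cong[of _ _ exp]) (simp add: field_simps)
    also have "\<dots> = exp (w * of_real (-1/2)) * exp w" by (rule exp_add)
    also have "exp w = 1"
      unfolding exp_eq_1 w_def by (auto intro: exI[of _ "- k"])
    finally show ?thesis by simp
  qed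
  ultimately show ?thesis using False by (simp add: w_def integral_unique)
qed simp

text \<open>Chernoff's argument: dividing \<open>g - g 0\<close> by \<open>exp (2\<pi>iz) - 1\<close> makes the partial Fourier sums
  telescope.\<close>

lemma fourier_sum_at_0:
  fixes g :: "complex \<Rightarrow> complex" and c :: "int \<Rightarrow> complex"
  assumes g: "g holomorphic_on UNIV"
    and c: "\<And>k. c k = integral {-1/2..1/2} (\<lambda>x. g (of_real x) * exp (- 2 * of_real pi * \<i> * of_int k * of_real x))"
    and sum: "(c has_sum S) UNIV"
  shows "S = g 0"
proof -
  define E where "E = (\<lambda>z::complex. exp (2 * of_real pi * \<i> * z))"
  \<comment> \<open>The quotient of \<open>g z - g 0\<close> by \<open>E z - 1\<close> is written as
    \<open>u / v\<close> with both numerator and denominator divided by \<open>z\<close>, which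
    removes the singularity at 0. Since E'(0) = 2 pi i, \<open>v\<close> vanishes only at the
    nonzero integers, all of them away from [-1/2, 1/2].\<close>
  define u where "u = (\<lambda>z. if z = 0 then deriv g 0 else (g z - g 0) / (z - 0))"
  define v where "v = (\<lambda>z. if z = 0 then deriv E 0 else (E z - E 0) / (z - 0))"
  have holE: "E holomorphic_on UNIV" unfolding E_def by (intro holomorphic_intros)
  have u: "u holomorphic_on UNIV" unfolding u_def by (rule pole_lemma) (use g in auto)
  have v: "v holomorphic_on UNIV" unfolding v_def by (rule pole_lemma) (use holE in auto)
  define U where "U = {z. v z \<noteq> 0}"
  have openU: "open U"
  proof -
    have "open (v -` (- {0}))"
      using holomorphic_on_imp_continuous_on[OF v] by (intro open_vimage) auto
    then show ?thesis by (simp add: U_def vimage_def)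
  qed
  define h where "h = (\<lambda>z. u z / v z)"
  have h: "h holomorphic_on U"
    unfolding h_def
    by (intro holomorphic_on_divide holomorphic_on_subset[OF u] holomorphic_on_subset[OF v]) (auto simp: U_def)
  have dE: "deriv E 0 = 2 * of_real pi * \<i>"
    unfolding E_def by (rule DERIV_imp_deriv) (auto intro!: derivative_eq_intros)
  have inU: "of_real x \<in> U" if x: "x \<in> {-1/2..1/2}" for x
  proof (cases "x = 0")
    case True
    then show ?thesis using dE by (simp add: U_def v_def)
  next
    case False
    have "E (of_real x) \<noteq> 1"
    proof
      assume "E (of_real x) = 1"
      then obtain n :: int where "2 * pi * x = of_int (2 * n) * pi"
        unfolding E_def exp_eq_1 by auto
      then have "x = of_int n" by simp
      with x False show False by (cases "n = 0") (auto simp: abs_le_iff)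
    qed
    then show ?thesis using False by (simp add: U_def v_def E_def)
  qed
  have hE: "h (of_real x) * (E (of_real x) - 1) = g (of_real x) - g 0" if x: "x \<in> {-1/2..1/2}" for x
  proof -
    have "v z * z = E z - 1" "u z * z = g z - g 0" for z
      by (auto simp: u_def v_def E_def)
    then have "h (of_real x) * (E (of_real x) - 1) = h (of_real x) * (v (of_real x) * of_real x)" by simp
    also have "\<dots> = u (of_real x) * of_real x"
      using inU[OF x] by (simp add: h_def U_def)
    finally show ?thesis using \<open>\<And>z. u z * z = g z - g 0\<close> by simp
  qed
  define e where "e = (\<lambda>(k::int) (x::real). exp (- 2 * of_real pi * \<i> * of_int k * of_real x) :: complex)"
  have ce [continuous_intros]: "continuous_on A (e k)" for A k
    unfolding e_def by (intro continuous_intros)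
  have norm_e: "norm (e k x) = 1" for k x by (simp add: e_def)
  have ch: "continuous_on {-1/2..1/2} (\<lambda>x. h (of_real x))"
    by (rule continuous_on_compose2[OF holomorphic_on_imp_continuous_on[OF h]])
      (use inU in \<open>auto intro!: continuous_intros\<close>)
  have ch': "continuous_on {-1/2..1/2} (\<lambda>x. deriv h (of_real x))"
    by (rule continuous_on_compose2[OF holomorphic_on_imp_continuous_on[OF holomorphic_deriv[OF h openU]]])
      (use inU in \<open>auto intro!: continuous_intros\<close>)
  have cg: "continuous_on {-1/2..1/2} (\<lambda>x. g (of_real x))"
    by (rule continuous_on_compose2[OF holomorphic_on_imp_continuous_on[OF g]])
      (auto intro!: continuous_intros)
  define d where "d = (\<lambda>k. integral {-1/2..1/2} (\<lambda>x. h (of_real x) * e k x))"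
  \<comment> \<open>Multiplication by \<open>E\<close> lowers the frequency index by one, so
    \<open>h\<close> times (\<open>E\<close> - 1) has coefficients \<open>d (k - 1) - d k\<close>;
    the constant \<open>g 0\<close> contributes at \<open>k = 0\<close> only.\<close>
  have tele: "c k = (if k = 0 then g 0 else 0) + (d (k - 1) - d k)" for k
  proof -
    have "integral {-1/2..1/2} (\<lambda>x. h (of_real x) * e (k - 1) x - h (of_real x) * e k x) = d (k - 1) - d k"
      unfolding d_def by (intro Henstock_Kurzweil_Integration.integral_diff integrable_continuous_real continuous_intros ch)
    also have "integral {-1/2..1/2} (\<lambda>x. h (of_real x) * e (k - 1) x - h (of_real x) * e k x) =
        integral {-1/2..1/2} (\<lambda>x. g (of_real x) * e k x - g 0 * e k x)"
    proof (rule Henstock_Kurzweil_Integration.integral_cong)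
      fix x :: real assume x: "x \<in> {-1/2..1/2}"
      have "e (k - 1) x = E (of_real x) * e k x"
        unfolding e_def E_def exp_add[symmetric] by (rule arg_cong[of _ _ exp]) (simp add: algebra_simps)
      then have "h (of_real x) * e (k - 1) x - h (of_real x) * e k x = (h (of_real x) * (E (of_real x) - 1)) * e k x"
        by (simp add: algebra_simps)
      then show "h (of_real x) * e (k - 1) x - h (of_real x) * e k x = g (of_real x) * e k x - g 0 * e k x"
        unfolding hE[OF x] by (simp add: algebra_simps)
    qed
    also have "\<dots> = integral {-1/2..1/2} (\<lambda>x. g (of_real x) * e k x) - integral {-1/2..1/2} (\<lambda>x. g 0 * e k x)"
      by (intro Henstock_Kurzweil_Integration.integral_diff integrable_continuous_real continuous_intros cg)
    also have "integral {-1/2..1/2} (\<lambda>x. g (of_real x) * e k x) = c k"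
      unfolding c e_def ..
    also have "integral {-1/2..1/2} (\<lambda>x. g 0 * e k x) = (if k = 0 then g 0 else 0)"
      unfolding e_def using integral_exp_character[of k] by simp
    finally show ?thesis by (simp add: algebra_simps)
  qed
  obtain M where M: "\<And>x. x \<in> {-1/2..1/2} \<Longrightarrow> norm (deriv h (of_real x)) \<le> M"
  proof -
    have "compact ((\<lambda>x. deriv h (of_real x)) ` {-1/2..1/2::real})"
      by (intro compact_continuous_image ch' compact_Icc)
    then show ?thesis using that by (meson bounded_iff compact_imp_bounded imageI)
  qed
  define K where "K = norm (h (1/2)) + norm (h (-1/2)) + M"
  \<comment> \<open>One integration by parts gives decay like 1/|k|. The boundary terms at 1/2 and
    -1/2 are merely bounded, and \<open>M\<close> bounds the derivative on an interval of length 1;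
    their total is \<open>K\<close>.\<close>
  have bound: "norm (d k) \<le> K / (2 * pi) / \<bar>real_of_int k\<bar>" if k: "k \<noteq> 0" for k
  proof -
    define w where "w = - 2 * of_real pi * \<i> * (of_int k :: complex)"
    have w: "norm w = 2 * pi * \<bar>real_of_int k\<bar>" by (simp add: w_def norm_mult)
    have "((\<lambda>x. deriv h (of_real x) * e k x + h (of_real x) * (w * e k x)) has_integral
        (h (of_real (1/2)) * e k (1/2) - h (of_real (-1/2)) * e k (-1/2))) {-1/2..1/2}"
    proof (rule fundamental_theorem_of_calculus)
      fix x :: real assume x: "x \<in> {-1/2..1/2}"
      have "(h has_field_derivative deriv h (of_real x)) (at (of_real x))"
        using holomorphic_derivI[OF h openU inU[OF x]] .
      then have "((\<lambda>z. h z * exp (w * z)) has_field_derivative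
          deriv h (of_real x) * e k x + h (of_real x) * (w * e k x)) (at (of_real x))"
        by (auto intro!: derivative_eq_intros simp: e_def w_def)
      then have "((\<lambda>x. h (of_real x) * exp (w * of_real x)) has_vector_derivative
          deriv h (of_real x) * e k x + h (of_real x) * (w * e k x)) (at x within {-1/2..1/2})"
        by (rule has_vector_derivative_real_field)
      then show "((\<lambda>x. h (of_real x) * e k x) has_vector_derivative
          deriv h (of_real x) * e k x + h (of_real x) * (w * e k x)) (at x within {-1/2..1/2})"
        by (simp add: e_def w_def)
    qed simp
    then have "h (of_real (1/2)) * e k (1/2) - h (of_real (-1/2)) * e k (-1/2) =
        integral {-1/2..1/2} (\<lambda>x. deriv h (of_real x) * e k x + h (of_real x) * (w * e k x))"
      by (simp add: integral_unique)
    also have "\<dots> = integral {-1/2..1/2} (\<lambda>x. deriv h (of_real x) * e k x)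
        + integral {-1/2..1/2} (\<lambda>x. h (of_real x) * (w * e k x))"
      by (intro Henstock_Kurzweil_Integration.integral_add integrable_continuous_real continuous_intros ch ch')
    also have "integral {-1/2..1/2} (\<lambda>x. h (of_real x) * (w * e k x)) = w * d k"
      unfolding d_def by (simp add: mult.left_commute[of _ w])
    finally have "w * d k = h (of_real (1/2)) * e k (1/2) - h (of_real (-1/2)) * e k (-1/2)
        - integral {-1/2..1/2} (\<lambda>x. deriv h (of_real x) * e k x)"
      by (simp add: algebra_simps)
    then have "norm (w * d k) \<le> norm (h (of_real (1/2)) * e k (1/2)) + norm (h (of_real (-1/2)) * e k (-1/2))
        + norm (integral {-1/2..1/2} (\<lambda>x. deriv h (of_real x) * e k x))"
      by (metis (no_types, lifting) add_right_mono norm_triangle_ineq4 order_trans)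
    also have "norm (integral {-1/2..1/2} (\<lambda>x. deriv h (of_real x) * e k x)) \<le> M * (1/2 - (-1/2))"
      by (rule integral_bound)
        (use M ch' in \<open>auto simp: norm_mult norm_e intro!: continuous_intros\<close>)
    finally have "norm (w * d k) \<le> K" by (simp add: K_def norm_mult norm_e)
    then show ?thesis using k by (simp add: norm_mult w field_simps)
  qed
  have lim1: "(\<lambda>N. d (int N)) \<longlonglongrightarrow> 0"
  proof (rule Lim_null_comparison)
    show "\<forall>\<^sub>F N in sequentially. norm (d (int N)) \<le> K / (2 * pi) / real N"
      using eventually_gt_at_top[of 0]
    proof eventually_elim
      case (elim N)
      then show ?case using bound[of "int N"] by simp
    qed
    show "(\<lambda>N. K / (2 * pi) / real N) \<longlonglongrightarrow> 0" by (rule lim_const_over_n)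
  qed
  have lim2: "(\<lambda>N. d (- int N)) \<longlonglongrightarrow> 0"
  proof (rule Lim_null_comparison)
    show "\<forall>\<^sub>F N in sequentially. norm (d (- int N)) \<le> K / (2 * pi) / real N"
      using eventually_gt_at_top[of 0]
    proof eventually_elim
      case (elim N)
      then show ?case using bound[of "- int N"] by simp
    qed
    show "(\<lambda>N. K / (2 * pi) / real N) \<longlonglongrightarrow> 0" by (rule lim_const_over_n)
  qed
  \<comment> \<open>Telescoping from -N to N leaves \<open>d\<close> at -N-1 and at N; the left
    index is one further out because \<open>tele\<close> involves \<open>k - 1\<close>.\<close>
  have partial: "(\<Sum>k\<in>{- int N..int N}. c k) = g 0 + d (- int (Suc N)) - d (int N)" for N
  proof (induction N)
    case 0
    show ?case using tele[of 0] by simp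
  next
    case (Suc N)
    have "{- int (Suc N)..int (Suc N)} = insert (- int (Suc N)) (insert (int (Suc N)) {- int N..int N})"
      by auto
    then have "(\<Sum>k\<in>{- int (Suc N)..int (Suc N)}. c k) =
        c (- int (Suc N)) + c (int (Suc N)) + (\<Sum>k\<in>{- int N..int N}. c k)"
      by (simp add: algebra_simps)
    moreover have "c (- int (Suc N)) = d (- int (Suc (Suc N))) - d (- int (Suc N))"
      using tele[of "- int (Suc N)"] by (simp add: algebra_simps)
    moreover have "c (int (Suc N)) = d (int N) - d (int (Suc N))"
      using tele[of "int (Suc N)"] by simp
    ultimately show ?case unfolding Suc by simp
  qed
  have "(\<lambda>N. \<Sum>k\<in>{- int N..int N}. c k) \<longlonglongrightarrow> g 0 + 0 - 0"
    unfolding partial by (intro tendsto_intros lim1 LIMSEQ_Suc[OF lim2])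
  with has_sum_int_LIMSEQ[OF sum] show ?thesis
    using LIMSEQ_unique by fastforce
qed

section \<open>Theta inversion for real parameters\<close>

lemma gauss_fourier_transform:
  fixes s k a :: real
  assumes s: "s > 0"
  shows "has_bochner_integral lborel
    (\<lambda>x. exp (- of_real pi * of_real s * (of_real x + of_real a)\<^sup>2) * exp (- 2 * of_real pi * \<i> * of_real k * of_real x))
    (exp (- of_real pi * of_real k ^ 2 / of_real s + 2 * of_real pi * \<i> * of_real k * of_real a) / of_real (sqrt s) :: complex)"
proof -
  \<comment> \<open>The formula is the characteristic function of the standard normal law after the
    substitution x -> c(x + a). The choice of \<open>c\<close> makes (c(x+a))^2/2 equal to pi s
    (x+a)^2, and \<open>t\<close> makes t c x equal to -2 pi k x. The prefactor used below removes
    the normalization of the density and the phase t c a.\<close>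
  define c where "c = sqrt (2 * pi * s)"
  define t where "t = - (2 * pi * k) / c"
  have c: "c > 0" "c\<^sup>2 = 2 * pi * s" using s by (simp_all add: c_def)
  have c': "c = sqrt (2 * pi) * sqrt s" by (simp add: c_def real_sqrt_mult)
  interpret real_distribution std_normal_distribution by (rule real_dist_normal_dist)
  have "integrable std_normal_distribution (\<lambda>x. iexp (t * x))"
    by (rule integrable_iexp) auto
  then have "integrable lborel (\<lambda>x. std_normal_density x *\<^sub>R iexp (t * x))"
    by (subst (asm) integrable_density) (auto simp: normal_density_nonneg)
  moreover have "integral\<^sup>L lborel (\<lambda>x. std_normal_density x *\<^sub>R iexp (t * x)) = exp (- (t^2) / 2)"
    using fun_cong[OF char_std_normal_distribution, of t] unfolding char_def
    by (subst (asm) integral_density) (auto simp: normal_density_nonneg)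
  ultimately have "has_bochner_integral lborel (\<lambda>x. std_normal_density x *\<^sub>R iexp (t * x)) (exp (- (t^2) / 2))"
    unfolding has_bochner_integral_iff by blast
  then have "has_bochner_integral lborel (\<lambda>x. std_normal_density (c * a + c * x) *\<^sub>R iexp (t * (c * a + c * x)))
      (of_real (exp (- (t^2) / 2)) /\<^sub>R \<bar>c\<bar>)"
    by (rule iffD1[OF lborel_has_bochner_integral_real_affine_iff, rotated]) (use c(1) in simp)
  then have "has_bochner_integral lborel (\<lambda>x. (of_real (sqrt (2 * pi)) * iexp (2 * pi * k * a)) *
        (std_normal_density (c * a + c * x) *\<^sub>R iexp (t * (c * a + c * x))))
      ((of_real (sqrt (2 * pi)) * iexp (2 * pi * k * a)) * (of_real (exp (- (t^2) / 2)) /\<^sub>R \<bar>c\<bar>))"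
    by (rule has_bochner_integral_mult_right)
  moreover have "(of_real (sqrt (2 * pi)) * iexp (2 * pi * k * a)) *
        (std_normal_density (c * a + c * x) *\<^sub>R iexp (t * (c * a + c * x))) =
      exp (- of_real pi * of_real s * (of_real x + of_real a)\<^sup>2) * exp (- 2 * of_real pi * \<i> * of_real k * of_real x)" for x
  proof -
    have ca: "c * a + c * x = c * (x + a)" by (simp add: algebra_simps)
    have "sqrt (2 * pi) * std_normal_density (c * a + c * x) = exp (- pi * s * (x + a)\<^sup>2)"
      unfolding std_normal_density_def ca by (simp add: power_mult_distrib c(2))
    then have 1: "of_real (sqrt (2 * pi)) * of_real (std_normal_density (c * a + c * x)) =
        complex_of_real (exp (- pi * s * (x + a)\<^sup>2))"
      by (metis of_real_mult)
    have 2: "complex_of_real (exp (- pi * s * (x + a)\<^sup>2)) = exp (- of_real pi * of_real s * (of_real x + of_real a)\<^sup>2)"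
      by (subst exp_of_real[symmetric]) simp
    have "t * (c * (x + a)) = - (2 * pi * k) * (x + a)"
      unfolding t_def using c(1) by simp
    then have "2 * pi * k * a + t * (c * a + c * x) = - 2 * pi * k * x"
      unfolding ca by (simp add: distrib_left)
    then have "iexp (2 * pi * k * a) * iexp (t * (c * a + c * x)) = iexp (- 2 * pi * k * x)"
      by (simp only: exp_add[symmetric] distrib_left[symmetric, of \<i>] of_real_add[symmetric])
    also have "\<i> * complex_of_real (- 2 * pi * k * x) = - 2 * of_real pi * \<i> * of_real k * of_real x" by simp
    finally have 3: "iexp (2 * pi * k * a) * iexp (t * (c * a + c * x)) = exp (- 2 * of_real pi * \<i> * of_real k * of_real x)" .
    have "(of_real (sqrt (2 * pi)) * iexp (2 * pi * k * a)) *
        (std_normal_density (c * a + c * x) *\<^sub>R iexp (t * (c * a + c * x))) =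
        (of_real (sqrt (2 * pi)) * of_real (std_normal_density (c * a + c * x))) *
        (iexp (2 * pi * k * a) * iexp (t * (c * a + c * x)))"
      unfolding scaleR_conv_of_real by (simp only: mult_ac)
    then show ?thesis unfolding 1 2 3 .
  qed
  moreover have "(of_real (sqrt (2 * pi)) * iexp (2 * pi * k * a)) * (of_real (exp (- (t^2) / 2)) /\<^sub>R \<bar>c\<bar>) =
      exp (- of_real pi * of_real k ^ 2 / of_real s + 2 * of_real pi * \<i> * of_real k * of_real a) / of_real (sqrt s)"
  proof -
    have "t\<^sup>2 = 4 * pi\<^sup>2 * k\<^sup>2 / (2 * pi * s)"
      unfolding t_def power_divide c(2) by (simp add: power_mult_distrib)
    then have "- (t^2) / 2 = - pi * k\<^sup>2 / s"
      using s by (simp add: field_simps power2_eq_square)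
    then have 1: "of_real (exp (- (t^2) / 2)) = exp (- of_real pi * of_real k ^ 2 / of_real s :: complex)"
      by (simp only:) (subst exp_of_real[symmetric], simp)
    have "sqrt (2 * pi) / c = 1 / sqrt s" unfolding c' by simp
    then have 2: "of_real (sqrt (2 * pi)) / of_real c = 1 / complex_of_real (sqrt s)"
      by (metis of_real_1 of_real_divide)
    have 3: "\<i> * complex_of_real (2 * pi * k * a) = 2 * of_real pi * \<i> * of_real k * of_real a" by simp
    have "(of_real (sqrt (2 * pi)) * iexp (2 * pi * k * a)) * (of_real (exp (- (t^2) / 2)) /\<^sub>R \<bar>c\<bar>) =
        (of_real (sqrt (2 * pi)) / of_real c) * (of_real (exp (- (t^2) / 2)) * iexp (2 * pi * k * a))"
      using c(1) unfolding scaleR_conv_of_real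
      by (simp only: abs_of_pos of_real_inverse divide_inverse mult_ac)
    then show ?thesis unfolding 1 2 3 exp_add by simp
  qed
  ultimately show ?thesis by (simp only:)
qed

text \<open>The unit intervals around the integers tile the line: a symmetric partial sum is the
  integral of \<open>f\<close> over [-N-1/2, N+1/2], and absolute integrability lets these exhaust
  the whole integral.\<close>

lemma integral_int_translates:
  fixes f :: "real \<Rightarrow> complex"
  assumes int: "has_bochner_integral lborel f I" and cont: "continuous_on UNIV f"
    and sum: "((\<lambda>n::int. integral {-1/2..1/2} (\<lambda>x. f (x + of_int n))) has_sum J) UNIV"
  shows "J = I"
proof -
  have fi: "f integrable_on {a..b}" for a b
    by (intro integrable_continuous_real continuous_on_subset[OF cont]) auto
  have part: "(\<Sum>n\<in>{- int N..int N}. integral {-1/2..1/2} (\<lambda>x. f (x + of_int n))) =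
      integral {- real N - 1/2..real N + 1/2} f" for N
  proof (induction N)
    case (Suc N)
    have "{- int (Suc N)..int (Suc N)} = insert (- int (Suc N)) (insert (int (Suc N)) {- int N..int N})"
      by auto
    then have "(\<Sum>n\<in>{- int (Suc N)..int (Suc N)}. integral {-1/2..1/2} (\<lambda>x. f (x + of_int n))) =
        integral {-1/2..1/2} (\<lambda>x. f (x + of_int (- int (Suc N)))) + integral {-1/2..1/2} (\<lambda>x. f (x + of_int (int (Suc N))))
        + integral {- real N - 1/2..real N + 1/2} f"
      unfolding Suc[symmetric] by (simp only: sum.insert finite_insert finite_atLeastAtMost_int) simp
    also have "integral {-1/2..1/2} (\<lambda>x. f (x + of_int (- int (Suc N)))) = integral {- real (Suc N) - 1/2..- real N - 1/2} f"
    proof -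
      have "(\<lambda>x. f (x + of_int (- int (Suc N)))) = f \<circ> (+) (- real (Suc N))"
        by (intro ext) (simp add: add.commute)
      moreover have "-1/2 + - real (Suc N) = - real (Suc N) - 1/2" "1/2 + - real (Suc N) = - real N - 1/2"
        by simp_all
      ultimately show ?thesis
        using integral_shift_Icc_real[of "-1/2" "1/2" f "- real (Suc N)"] by (simp only:)
    qed
    also have "integral {-1/2..1/2} (\<lambda>x. f (x + of_int (int (Suc N)))) = integral {real N + 1/2..real (Suc N) + 1/2} f"
    proof -
      have "(\<lambda>x. f (x + of_int (int (Suc N)))) = f \<circ> (+) (real (Suc N))"
        by (intro ext) (simp add: add.commute)
      moreover have "-1/2 + real (Suc N) = real N + 1/2" "1/2 + real (Suc N) = real (Suc N) + 1/2"
        by simp_all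
      ultimately show ?thesis
        using integral_shift_Icc_real[of "-1/2" "1/2" f "real (Suc N)"] by (simp only:)
    qed
    finally have *: "(\<Sum>n\<in>{- int (Suc N)..int (Suc N)}. integral {-1/2..1/2} (\<lambda>x. f (x + of_int n))) =
        (integral {- real (Suc N) - 1/2..- real N - 1/2} f + integral {- real N - 1/2..real N + 1/2} f)
        + integral {real N + 1/2..real (Suc N) + 1/2} f"
      by (simp add: algebra_simps)
    have "integral {- real (Suc N) - 1/2..- real N - 1/2} f + integral {- real N - 1/2..real N + 1/2} f =
        integral {- real (Suc N) - 1/2..real N + 1/2} f"
      by (rule Henstock_Kurzweil_Integration.integral_combine) (auto intro: fi)
    moreover have "integral {- real (Suc N) - 1/2..real N + 1/2} f + integral {real N + 1/2..real (Suc N) + 1/2} f =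
        integral {- real (Suc N) - 1/2..real (Suc N) + 1/2} f"
      by (rule Henstock_Kurzweil_Integration.integral_combine) (auto intro: fi)
    ultimately show ?case unfolding * by simp
  qed simp
  let ?A = "\<lambda>N. {- real N - 1/2..real N + 1/2}"
  have UN: "(\<Union>N. ?A N) = UNIV"
  proof -
    have "x \<in> (\<Union>N. ?A N)" for x
    proof -
      obtain N where "\<bar>x\<bar> \<le> real N" using real_arch_simple by blast
      then have "x \<in> ?A N" by auto
      then show ?thesis by blast
    qed
    then show ?thesis by blast
  qed
  have "(\<lambda>N. LINT x:?A N|lborel. f x) \<longlonglongrightarrow> (LINT x:(\<Union>N. ?A N)|lborel. f x)"
  proof (rule set_integral_cont_up)
    show "incseq ?A" by (auto simp: incseq_def)
    show "set_integrable lborel (\<Union>N. ?A N) f"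
      unfolding UN set_integrable_def using int by (simp add: has_bochner_integral_iff)
  qed simp
  moreover have "(LINT x:?A N|lborel. f x) = integral (?A N) f" for N
    using int unfolding has_bochner_integral_iff
    by (intro set_borel_integral_eq_integral(2) set_integrable_subset[of lborel UNIV f "?A N"]) (auto simp: set_integrable_def)
  moreover have "(LINT x:(\<Union>N. ?A N)|lborel. f x) = I"
    unfolding UN set_lebesgue_integral_def using int by (simp add: has_bochner_integral_iff)
  ultimately have "(\<lambda>N. integral (?A N) f) \<longlonglongrightarrow> I" by simp
  with has_sum_int_LIMSEQ[OF sum] show ?thesis
    unfolding part by (rule LIMSEQ_unique)
qed

text \<open>The function sum_n exp(-pi s (x+a+n)^2) has as k-th Fourier coefficient the Fourier
  transform of a single Gaussian at k, by unfolding over the integer translates. Evaluating its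
  Fourier series at 0 is enough because the point of interest is carried by the shift
  \<open>a\<close>.\<close>

lemma theta_series_inversion_real:
  fixes s a :: real
  assumes s: "s > 0"
  shows "exp (- of_real pi * of_real s * (of_real a)\<^sup>2) * theta_series (of_real s) (\<i> * of_real s * of_real a) =
    theta_series (1 / of_real s) (of_real a) / of_real (sqrt s)"
proof -
  \<comment> \<open>Expanding (z+a+n)^2 pulls out the factor free of n; the mixed term -2 pi s n
    (z+a) is the theta character at argument i s (z+a). This form shows that \<open>g\<close> is
    entire.\<close>
  define g where "g = (\<lambda>z. exp (- of_real pi * of_real s * (z + of_real a)\<^sup>2) * theta_series (of_real s) (\<i> * of_real s * (z + of_real a)))"
  have g: "g holomorphic_on UNIV"
  proof -
    have "(\<lambda>z. theta_series (of_real s) (\<i> * of_real s * (z + of_real a))) holomorphic_on UNIV"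
      by (rule theta_series_holomorphic; (intro holomorphic_intros)?) (use s in auto)
    then show ?thesis unfolding g_def by (intro holomorphic_intros)
  qed
  define f where "f = (\<lambda>(k::int) x. exp (- of_real pi * of_real s * (of_real x + of_real a)\<^sup>2) * exp (- 2 * of_real pi * \<i> * of_int k * of_real x) :: complex)"
  define c where "c = (\<lambda>k::int. exp (- of_real pi * (of_int k) ^ 2 / of_real s + 2 * of_real pi * \<i> * of_int k * of_real a) / of_real (sqrt s) :: complex)"
  have fint: "has_bochner_integral lborel (f k) (c k)" for k
    unfolding f_def c_def using gauss_fourier_transform[OF s, of a "of_int k"] by simp
  have fcont: "continuous_on A (f k)" for A k
    unfolding f_def by (intro continuous_intros)
  let ?t = "\<lambda>(n::int) x. exp (- of_real pi * of_real s * (of_int n)\<^sup>2 + 2 * of_real pi * \<i> * of_int n * (\<i> * of_real s * (of_real x + of_real a))) :: complex"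
  have f_shift: "f k (x + of_int n) = f k x * ?t n x" for k n x
  proof -
    have "exp (- 2 * of_real pi * \<i> * of_int k * of_real (x + of_int n)) =
        exp (- 2 * of_real pi * \<i> * of_int k * of_real x) * exp (2 * of_int (- k * n) * of_real pi * \<i>)"
      unfolding exp_add[symmetric] by (rule arg_cong[of _ _ exp]) (simp add: algebra_simps)
    also have "exp (2 * of_int (- k * n) * of_real pi * \<i>) = 1"
      unfolding exp_eq_1 by (auto intro: exI[of _ "- k * n"])
    finally have 1: "exp (- 2 * of_real pi * \<i> * of_int k * of_real (x + of_int n)) = exp (- 2 * of_real pi * \<i> * of_int k * of_real x)"
      by simp
    have 2: "exp (- of_real pi * of_real s * (of_real (x + of_int n) + of_real a)\<^sup>2) =
        exp (- of_real pi * of_real s * (of_real x + of_real a)\<^sup>2) * ?t n x"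
      unfolding exp_add[symmetric] by (rule arg_cong[of _ _ exp]) (simp add: algebra_simps power2_eq_square)
    show ?thesis unfolding f_def 1 2 by simp
  qed
  have norm_f: "norm (f k x) \<le> 1" for k x
  proof -
    have "f k x = of_real (exp (- pi * s * (x + a)\<^sup>2)) * exp (- 2 * of_real pi * \<i> * of_int k * of_real x)"
      unfolding f_def by (subst exp_of_real[symmetric]) simp
    then show ?thesis using s by (simp add: norm_mult del: of_real_exp)
  qed
  have ck: "c k = integral {-1/2..1/2} (\<lambda>x. g (of_real x) * exp (- 2 * of_real pi * \<i> * of_int k * of_real x))" for k
  proof -
    have hs: "((\<lambda>n::int. integral {-1/2..1/2} (\<lambda>x. f k (x + of_int n))) has_sum
        integral {-1/2..1/2} (\<lambda>x. \<Sum>\<^sub>\<infinity>n::int. f k (x + of_int n))) UNIV"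
    proof (rule has_sum_integral_interval)
      show "continuous_on {-1/2..1/2} (\<lambda>x. f k (x + of_int n))" for n
        by (rule continuous_on_compose2[OF fcont]) (auto intro!: continuous_intros)
      show "(\<lambda>n::int. exp (- (pi * s) * (real_of_int n)\<^sup>2 + (2 * pi * (s * (1/2 + \<bar>a\<bar>))) * \<bar>real_of_int n\<bar>)) summable_on UNIV"
        by (rule summable_on_gauss_int) (use s in simp)
      show "norm (f k (x + of_int n)) \<le> exp (- (pi * s) * (real_of_int n)\<^sup>2 + (2 * pi * (s * (1/2 + \<bar>a\<bar>))) * \<bar>real_of_int n\<bar>)"
        if x: "x \<in> {-1/2..1/2}" for n :: int and x
      proof -
        have "norm (of_real x + of_real a :: complex) \<le> 1/2 + \<bar>a\<bar>"
          using x by (simp flip: of_real_add) auto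
        then have "norm (\<i> * of_real s * (of_real x + of_real a)) \<le> s * (1/2 + \<bar>a\<bar>)"
          using s by (simp add: norm_mult)
        then have "norm (?t n x) \<le> exp (- (pi * s) * (real_of_int n)\<^sup>2 + (2 * pi * (s * (1/2 + \<bar>a\<bar>))) * \<bar>real_of_int n\<bar>)"
          by (intro norm_theta_term_le) auto
        then have "norm (f k x) * norm (?t n x) \<le> 1 * exp (- (pi * s) * (real_of_int n)\<^sup>2 + (2 * pi * (s * (1/2 + \<bar>a\<bar>))) * \<bar>real_of_int n\<bar>)"
          by (intro mult_mono norm_f) auto
        then show ?thesis unfolding f_shift norm_mult by simp
      qed
    qed
    have "(\<Sum>\<^sub>\<infinity>n::int. f k (x + of_int n)) = g (of_real x) * exp (- 2 * of_real pi * \<i> * of_int k * of_real x)" for x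
      unfolding f_shift infsum_cmult_right' g_def theta_series_def[symmetric]
      by (simp add: f_def)
    with integral_int_translates[OF fint fcont hs] show ?thesis by simp
  qed
  have "(c has_sum (theta_series (1 / of_real s) (of_real a) / of_real (sqrt s))) UNIV"
  proof -
    have "((\<lambda>k::int. exp (- of_real pi * (1 / of_real s) * (of_int k)\<^sup>2 + 2 * of_real pi * \<i> * of_int k * of_real a))
        has_sum theta_series (1 / of_real s) (of_real a)) UNIV"
      unfolding theta_series_def by (intro has_sum_infsum theta_series_summable) (use s in simp)
    from has_sum_divide_const[OF this, of "of_real (sqrt s)"] show ?thesis
      by (simp add: c_def)
  qed
  from fourier_sum_at_0[OF g ck this] show ?thesis by (simp add: g_def)
qed

section \<open>Inversion and Poisson summation with complex parameters\<close>

lemma Re_inverse_pos: "Re s > 0 \<Longrightarrow> Re (1 / s) > 0"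
  by (auto simp: Re_divide sum_power2_gt_zero_iff)

text \<open>The identity theorem is applied twice, one variable at a time: in \<open>z\<close> from
  the real line to the plane with \<open>s\<close> positive and fixed, then in \<open>s\<close> from
  the positive axis to the right half-plane with \<open>z\<close> fixed. The principal root is
  holomorphic there and agrees with \<open>sqrt\<close> on the axis, which settles the
  branch.\<close>

lemma theta_series_inversion:
  fixes s z :: complex
  assumes s: "Re s > 0"
  shows "exp (- of_real pi * s * z\<^sup>2) * theta_series s (\<i> * s * z) = theta_series (1 / s) z / csqrt s"
proof -
  have real: "exp (- of_real pi * of_real s * z\<^sup>2) * theta_series (of_real s) (\<i> * of_real s * z) =
      theta_series (1 / of_real s) z / csqrt (of_real s)" if s: "s > 0" for s z
  proof -
    let ?F = "\<lambda>z. exp (- of_real pi * of_real s * z\<^sup>2) * theta_series (of_real s) (\<i> * of_real s * z)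
      - theta_series (1 / of_real s) z / of_real (sqrt s)"
    have "?F z = 0"
    proof (rule analytic_continuation[of ?F UNIV "\<real>" 0])
      show "?F holomorphic_on UNIV"
      proof -
        have "(\<lambda>z. theta_series (of_real s) (\<i> * of_real s * z)) holomorphic_on UNIV"
          by (rule theta_series_holomorphic; (intro holomorphic_intros)?) (use s in auto)
        moreover have "(\<lambda>z. theta_series (1 / of_real s) z) holomorphic_on UNIV"
          by (rule theta_series_holomorphic; (intro holomorphic_intros)?) (use s in auto)
        ultimately show ?thesis using s by (intro holomorphic_intros) auto
      qed
      show "0 islimpt (\<real> :: complex set)"
        unfolding islimpt_approachable
      proof (intro allI impI)
        fix e :: real assume "e > 0"
        then show "\<exists>x'\<in>\<real>. x' \<noteq> (0::complex) \<and> dist x' 0 < e"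
          by (intro bexI[of _ "of_real (e/2)"]) auto
      qed
      show "?F z = 0" if "z \<in> \<real>" for z
        using that theta_series_inversion_real[OF s] by (auto elim!: Reals_cases)
    qed auto
    then show ?thesis using s by simp
  qed
  let ?G = "\<lambda>s. exp (- of_real pi * s * z\<^sup>2) * theta_series s (\<i> * s * z) - theta_series (1 / s) z / csqrt s"
  let ?H = "{s. Re s > 0}"
  have "?G s = 0"
  proof (rule analytic_continuation[of ?G ?H "of_real ` {0<..}" 1])
    show "open ?H" by (rule open_halfspace_Re_gt)
    show "connected ?H" by (intro convex_connected convex_halfspace_Re_gt)
    show "?G holomorphic_on ?H"
    proof -
      have "(\<lambda>s. theta_series s (\<i> * s * z)) holomorphic_on ?H"
        by (rule theta_series_holomorphic; (intro holomorphic_intros open_halfspace_Re_gt)?) auto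
      moreover have "(\<lambda>s. theta_series (1 / s) z) holomorphic_on ?H"
        by (rule theta_series_holomorphic; (intro holomorphic_intros open_halfspace_Re_gt Re_inverse_pos)?) auto
      ultimately show ?thesis
        by (intro holomorphic_intros) (auto simp: complex_nonpos_Reals_iff)
    qed
    show "1 islimpt (complex_of_real ` {0<..})"
      unfolding islimpt_approachable
    proof (intro allI impI)
      fix e :: real assume e: "e > 0"
      have "dist (complex_of_real (1 + e/2)) 1 = e / 2" "complex_of_real (1 + e/2) \<noteq> 1"
        using e by (simp_all add: dist_norm)
      moreover have "complex_of_real (1 + e/2) \<in> complex_of_real ` {0<..}"
        using e by (intro imageI) simp
      ultimately show "\<exists>x'\<in>complex_of_real ` {0<..}. x' \<noteq> 1 \<and> dist x' 1 < e"
        using e by (intro bexI[of _ "complex_of_real (1 + e/2)"]) simp_all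
    qed
    show "?G s = 0" if "s \<in> of_real ` {0<..}" for s
      using that real by auto
  qed (use s in auto)
  then show ?thesis by simp
qed

text \<open>Completing the square moves the character into the shift: the exponent is that of a
  Gaussian in n + z with \<open>z = a - \<i> * w / s\<close>, up to the constant factor
  \<open>q\<close>. Complex \<open>w\<close> is essential, as the cross term of a planar form enters
  through it.\<close>

lemma gauss_poisson:
  fixes s a w :: complex
  assumes s: "Re s > 0"
  shows "(\<Sum>\<^sub>\<infinity>n::int. exp (- of_real pi * s * (of_int n + a)\<^sup>2 + 2 * of_real pi * \<i> * (of_int n + a) * w)) =
    (\<Sum>\<^sub>\<infinity>k::int. exp (- of_real pi * (of_int k - w)\<^sup>2 / s + 2 * of_real pi * \<i> * of_int k * a)) / csqrt s"
proof -
  have s0: "s \<noteq> 0" using s by auto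
  define z where "z = a - \<i> * w / s"
  define q where "q = exp (- of_real pi * w\<^sup>2 / s)"
  have "exp (- of_real pi * s * (of_int n + a)\<^sup>2 + 2 * of_real pi * \<i> * (of_int n + a) * w) =
      q * exp (- of_real pi * s * z\<^sup>2) * exp (- of_real pi * s * (of_int n)\<^sup>2 + 2 * of_real pi * \<i> * of_int n * (\<i> * s * z))" for n
  proof -
    have "s * z = s * a - \<i> * w" "s * z\<^sup>2 = s * a\<^sup>2 - 2 * \<i> * a * w - w\<^sup>2 / s"
      using s0 by (simp_all add: z_def field_simps power2_eq_square)
    then have "- of_real pi * w\<^sup>2 / s + - of_real pi * (s * z\<^sup>2) + (- of_real pi * s * (of_int n)\<^sup>2 + 2 * of_real pi * \<i> * of_int n * (\<i> * (s * z))) =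
        - of_real pi * s * (of_int n + a)\<^sup>2 + 2 * of_real pi * \<i> * (of_int n + a) * w"
      by (simp only:) (simp add: algebra_simps power2_eq_square)
    then show ?thesis unfolding q_def exp_add[symmetric] by (simp add: mult.assoc)
  qed
  moreover have "exp (- of_real pi * (of_int k - w)\<^sup>2 / s + 2 * of_real pi * \<i> * of_int k * a) =
      q * exp (- of_real pi * (1 / s) * (of_int k)\<^sup>2 + 2 * of_real pi * \<i> * of_int k * z)" for k
    unfolding q_def z_def exp_add[symmetric]
    by (intro arg_cong[of _ _ exp])
      (simp add: power2_eq_square algebra_simps diff_divide_distrib add_divide_distrib)
  ultimately show ?thesis
    using theta_series_inversion[OF s, of z]
    unfolding theta_series_def by (simp only: infsum_cmult_right' mult.assoc times_divide_eq_right)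
qed

text \<open>The left-hand side is the determinant of the real part of the quadratic form that remains after
  Fourier transform in the first variable alone. It is positive, which is what allows the two
  summations to be exchanged between the one-dimensional steps.\<close>

lemma partial_fourier_discriminant:
  fixes \<alpha> \<beta> \<gamma> :: complex
  assumes "\<alpha> \<noteq> 0"
  shows "Re (1 / \<alpha>) * Re ((\<alpha> * \<gamma> - \<beta>\<^sup>2) / \<alpha>) - (Im (\<beta> / \<alpha>))\<^sup>2 = (Re \<alpha> * Re \<gamma> - (Re \<beta>)\<^sup>2) / (norm \<alpha>)\<^sup>2"
proof -
  define D where "D = (Re \<alpha>)\<^sup>2 + (Im \<alpha>)\<^sup>2"
  define E where "E = ((Re \<beta>)\<^sup>2 - (Im \<beta>)\<^sup>2) * Re \<alpha> + 2 * Re \<beta> * Im \<beta> * Im \<alpha>"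
  define J where "J = Im \<beta> * Re \<alpha> - Re \<beta> * Im \<alpha>"
  have D: "D \<noteq> 0" using assms by (simp add: D_def complex_eq_iff sum_power2_eq_zero_iff)
  have n: "(norm \<alpha>)\<^sup>2 = D" by (simp add: D_def cmod_power2)
  have 1: "Re (1 / \<alpha>) = Re \<alpha> / D" by (simp add: Re_divide D_def)
  have "(\<alpha> * \<gamma> - \<beta>\<^sup>2) / \<alpha> = \<gamma> - \<beta>\<^sup>2 / \<alpha>" using assms by (simp add: field_simps)
  moreover have "Re (\<beta>\<^sup>2 / \<alpha>) = E / D"
    by (simp add: Re_divide D_def E_def power2_eq_square algebra_simps)
  ultimately have 2: "Re ((\<alpha> * \<gamma> - \<beta>\<^sup>2) / \<alpha>) = Re \<gamma> - E / D"
    by simp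
  have 3: "Im (\<beta> / \<alpha>) = J / D" by (simp add: Im_divide D_def J_def)
  have "Re \<alpha> / D * (Re \<gamma> - E / D) - (J / D)\<^sup>2 = (Re \<alpha> * (Re \<gamma> * D - E) - J\<^sup>2) / D\<^sup>2"
    using D by (simp add: field_simps power2_eq_square)
  also have "Re \<alpha> * (Re \<gamma> * D - E) - J\<^sup>2 = (Re \<alpha> * Re \<gamma> - (Re \<beta>)\<^sup>2) * D"
    unfolding D_def E_def J_def by algebra
  also have "\<dots> / D\<^sup>2 = (Re \<alpha> * Re \<gamma> - (Re \<beta>)\<^sup>2) / D"
    using D by (simp add: power2_eq_square)
  finally show ?thesis unfolding 1 2 3 n .
qed

text \<open>The sum over m is transformed with modulus \<open>\<alpha>\<close>, n being a parameter;
  what is left in n has modulus d/\<alpha> = \<gamma> - \<beta>^2/\<alpha>, the Schur complement.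
  The two roots stay separate here since \<open>csqrt\<close> is not multiplicative; their product
  is evaluated where \<open>d\<close> is known to be positive.\<close>

lemma gauss_poisson_plane:
  fixes \<alpha> \<beta> \<gamma> :: complex and a1 a2 b1 b2 :: real
  assumes \<alpha>: "Re \<alpha> > 0" and D: "(Re \<beta>)\<^sup>2 < Re \<alpha> * Re \<gamma>"
  defines "d \<equiv> \<alpha> * \<gamma> - \<beta>\<^sup>2"
  shows "infsum (\<lambda>(m::int, n::int). exp (- of_real pi * (\<alpha> * of_real ((of_int m + a1)\<^sup>2)
        + 2 * \<beta> * of_real ((of_int m + a1) * (of_int n + a2)) + \<gamma> * of_real ((of_int n + a2)\<^sup>2))
        + 2 * of_real pi * \<i> * of_real ((of_int m + a1) * b1 + (of_int n + a2) * b2))) UNIV =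
    (\<Sum>\<^sub>\<infinity>k::int. \<Sum>\<^sub>\<infinity>l::int. exp (- of_real pi * (\<gamma> * of_real ((of_int k - b1)\<^sup>2)
        - 2 * \<beta> * of_real ((of_int k - b1) * (of_int l - b2)) + \<alpha> * of_real ((of_int l - b2)\<^sup>2)) / d
        + 2 * of_real pi * \<i> * of_real (of_int k * a1 + of_int l * a2))) / (csqrt \<alpha> * csqrt (d / \<alpha>))"
proof -
  have \<alpha>0: "\<alpha> \<noteq> 0" using \<alpha> by auto
  have disc: "(Im (\<beta> / \<alpha>))\<^sup>2 < Re (1 / \<alpha>) * Re (d / \<alpha>)"
  proof -
    have "0 < (Re \<alpha> * Re \<gamma> - (Re \<beta>)\<^sup>2) / (norm \<alpha>)\<^sup>2" using D \<alpha>0 by simp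
    then show ?thesis
      using partial_fourier_discriminant[OF \<alpha>0, of \<gamma> \<beta>] by (simp add: d_def)
  qed
  have i\<alpha>: "Re (1 / \<alpha>) > 0" by (rule Re_inverse_pos[OF \<alpha>])
  have d\<alpha>: "Re (d / \<alpha>) > 0"
    using disc i\<alpha> zero_less_mult_pos[of "Re (1 / \<alpha>)" "Re (d / \<alpha>)"] zero_le_power2[of "Im (\<beta> / \<alpha>)"] by linarith
  have d0: "d \<noteq> 0" using d\<alpha> by auto
  define f where "f = (\<lambda>(m::int) (n::int). exp (- of_real pi * (\<alpha> * of_real ((of_int m + a1)\<^sup>2)
        + 2 * \<beta> * of_real ((of_int m + a1) * (of_int n + a2)) + \<gamma> * of_real ((of_int n + a2)\<^sup>2))
        + 2 * of_real pi * \<i> * of_real ((of_int m + a1) * b1 + (of_int n + a2) * b2)))"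
  \<comment> \<open>The summand between the two transforms: \<open>k\<close> is already dual to
    \<open>m\<close>, while \<open>n\<close> is still untransformed.\<close>
  define h where "h = (\<lambda>(n::int) (k::int). exp (- of_real pi * (1 / \<alpha> * of_real ((of_int k - b1)\<^sup>2)
        + d / \<alpha> * of_real ((of_int n + a2)\<^sup>2))
        + 2 * of_real pi * \<i> * (of_real ((of_int n + a2) * b2) + \<beta> / \<alpha> * of_real ((of_int k - b1) * (of_int n + a2)) + of_real (of_int k * a1))))"
  define g where "g = (\<lambda>(k::int) (l::int). exp (- of_real pi * (\<gamma> * of_real ((of_int k - b1)\<^sup>2)
        - 2 * \<beta> * of_real ((of_int k - b1) * (of_int l - b2)) + \<alpha> * of_real ((of_int l - b2)\<^sup>2)) / d
        + 2 * of_real pi * \<i> * of_real (of_int k * a1 + of_int l * a2)))"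
  have fs: "(\<lambda>(m, n). f m n) summable_on UNIV \<times> UNIV"
  proof (rule abs_summable_summable)
    have "(\<lambda>(m::int, n::int). exp (- ((pi * Re \<alpha>) * (of_int m + a1)\<^sup>2
        + 2 * (pi * Re \<beta>) * (of_int m + a1) * (of_int n + a2) + (pi * Re \<gamma>) * (of_int n + a2)\<^sup>2))) summable_on UNIV"
      using \<alpha> D by (intro summable_on_gauss_plane) (auto simp: power_mult_distrib power2_eq_square)
    then show "(\<lambda>x. norm (case x of (m, n) \<Rightarrow> f m n)) summable_on UNIV \<times> UNIV"
      by (simp add: f_def case_prod_unfold algebra_simps)
  qed
  \<comment> \<open>The character in \<open>h\<close> is not unimodular: the imaginary part of
    \<beta>/\<alpha> contributes to the modulus and becomes the off-diagonal entry of the real form,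
    as in \<open>disc\<close>.\<close>
  have norm_h: "norm (exp (- of_real pi * (p * of_real X + q * of_real Y) + 2 * of_real pi * \<i> * (of_real x + r * of_real y + of_real z))) =
      exp (- (pi * Re q * Y + 2 * (pi * Im r) * y + pi * Re p * X))" for p q r X Y x y z
    by (simp add: algebra_simps)
  have hs: "(\<lambda>(n, k). h n k) summable_on UNIV \<times> UNIV"
  proof (rule abs_summable_summable)
    have "(\<lambda>(n::int, k::int). exp (- ((pi * Re (d / \<alpha>)) * (of_int n + a2)\<^sup>2
        + 2 * (pi * Im (\<beta> / \<alpha>)) * (of_int n + a2) * (of_int k + (- b1)) + (pi * Re (1 / \<alpha>)) * (of_int k + (- b1))\<^sup>2))) summable_on UNIV"
      using d\<alpha> disc by (intro summable_on_gauss_plane) (auto simp: power_mult_distrib power2_eq_square mult_ac)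
    then show "(\<lambda>x. norm (case x of (n, k) \<Rightarrow> h n k)) summable_on UNIV \<times> UNIV"
      by (simp only: h_def norm_h case_prod_unfold UNIV_Times_UNIV) (simp add: algebra_simps)
  qed
  have fh: "(\<Sum>\<^sub>\<infinity>m. f m n) = (\<Sum>\<^sub>\<infinity>k. h n k) / csqrt \<alpha>" for n
  proof -
    define N where "N = complex_of_real (of_int n + a2)"
    \<comment> \<open>For fixed \<open>n\<close> the cross term -2 pi \<beta> M N, with M = m + a1,
      is a character in M with imaginary coefficient, so it joins \<open>b1\<close>.\<close>
    define w where "w = of_real b1 + \<i> * \<beta> * N"
    define q where "q = exp (- of_real pi * \<gamma> * N\<^sup>2 + 2 * of_real pi * \<i> * N * of_real b2)"
    have "f m n = exp (- of_real pi * \<alpha> * (of_int m + of_real a1)\<^sup>2 + 2 * of_real pi * \<i> * (of_int m + of_real a1) * w) * q" for m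
      unfolding f_def q_def exp_add[symmetric] w_def of_real_mult of_real_add N_def[symmetric]
      by (rule arg_cong[of _ _ exp]) (simp add: N_def algebra_simps power2_eq_square)
    moreover have "h n k = exp (- of_real pi * (of_int k - w)\<^sup>2 / \<alpha> + 2 * of_real pi * \<i> * of_int k * of_real a1) * q" for k
    proof -
      have d\<alpha>_eq: "d / \<alpha> = \<gamma> - \<beta>\<^sup>2 / \<alpha>" using \<alpha>0 by (simp add: d_def field_simps)
      show ?thesis
        unfolding h_def d\<alpha>_eq q_def exp_add[symmetric] w_def
        by (intro arg_cong[of _ _ exp])
        (simp add: N_def algebra_simps power2_eq_square diff_divide_distrib add_divide_distrib)
    qed
    ultimately show ?thesis
      using gauss_poisson[OF \<alpha>, of "of_real a1" w] by (simp add: infsum_cmult_left')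
  qed
  have hg: "(\<Sum>\<^sub>\<infinity>n. h n k) = (\<Sum>\<^sub>\<infinity>l. g k l) / csqrt (d / \<alpha>)" for k
  proof -
    define K where "K = complex_of_real (of_int k - b1)"
    define w where "w = of_real b2 + \<beta> / \<alpha> * K"
    define q where "q = exp (- of_real pi * (1 / \<alpha>) * K\<^sup>2 + 2 * of_real pi * \<i> * of_int k * of_real a1)"
    have "h n k = exp (- of_real pi * (d / \<alpha>) * (of_int n + of_real a2)\<^sup>2 + 2 * of_real pi * \<i> * (of_int n + of_real a2) * w) * q" for n
      unfolding h_def q_def exp_add[symmetric] w_def
      by (rule arg_cong[of _ _ exp]) (simp add: K_def algebra_simps power2_eq_square)
    moreover have "g k l = exp (- of_real pi * (of_int l - w)\<^sup>2 / (d / \<alpha>) + 2 * of_real pi * \<i> * of_int l * of_real a2) * q" for l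
    proof -
      define L where "L = complex_of_real (of_int l - b2)"
      have lw: "of_int l - w = (\<alpha> * L - \<beta> * K) / \<alpha>" using \<alpha>0 by (simp add: L_def w_def field_simps)
      \<comment> \<open>The square is undone: the two one-variable exponents recombine into the
        inverse quadratic form, that is the adjugate divided by \<open>d\<close>.\<close>
      have "(of_int l - w)\<^sup>2 / (d / \<alpha>) + 1 / \<alpha> * K\<^sup>2 = ((\<alpha> * L - \<beta> * K)\<^sup>2 + d * K\<^sup>2) / (\<alpha> * d)"
        unfolding lw using \<alpha>0 d0 by (simp add: field_simps power2_eq_square)
      also have "(\<alpha> * L - \<beta> * K)\<^sup>2 + d * K\<^sup>2 = \<alpha> * (\<gamma> * K\<^sup>2 - 2 * \<beta> * (K * L) + \<alpha> * L\<^sup>2)"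
        unfolding d_def by algebra
      also have "\<dots> / (\<alpha> * d) = (\<gamma> * K\<^sup>2 - 2 * \<beta> * (K * L) + \<alpha> * L\<^sup>2) / d"
        using \<alpha>0 by simp
      finally have *: "- of_real pi * (\<gamma> * K\<^sup>2 - 2 * \<beta> * (K * L) + \<alpha> * L\<^sup>2) / d =
          - of_real pi * (of_int l - w)\<^sup>2 / (d / \<alpha>) + - of_real pi * (1 / \<alpha>) * K\<^sup>2"
        by (metis (no_types, lifting) distrib_left mult.assoc times_divide_eq_right)
      have "g k l = exp (- of_real pi * (\<gamma> * K\<^sup>2 - 2 * \<beta> * (K * L) + \<alpha> * L\<^sup>2) / d
          + 2 * of_real pi * \<i> * of_real (of_int k * a1 + of_int l * a2))"
        by (simp add: g_def K_def L_def)
      then show ?thesis unfolding * q_def exp_add[symmetric]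
        by (simp add: algebra_simps)
    qed
    ultimately show ?thesis
      using gauss_poisson[OF d\<alpha>, of "of_real a2" w] by (simp add: infsum_cmult_left')
  qed
  have "infsum (\<lambda>(m, n). f m n) UNIV = (\<Sum>\<^sub>\<infinity>m. \<Sum>\<^sub>\<infinity>n. f m n)"
    using infsum_Sigma'_banach[OF fs] by simp
  also have "\<dots> = (\<Sum>\<^sub>\<infinity>n. \<Sum>\<^sub>\<infinity>m. f m n)"
    by (rule infsum_swap_banach[OF fs])
  also have "\<dots> = (\<Sum>\<^sub>\<infinity>n. \<Sum>\<^sub>\<infinity>k. h n k) / csqrt \<alpha>"
    unfolding fh divide_inverse infsum_cmult_left' ..
  also have "(\<Sum>\<^sub>\<infinity>n. \<Sum>\<^sub>\<infinity>k. h n k) = (\<Sum>\<^sub>\<infinity>k. \<Sum>\<^sub>\<infinity>n. h n k)"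
    by (rule infsum_swap_banach[OF hs])
  also have "\<dots> = (\<Sum>\<^sub>\<infinity>k. \<Sum>\<^sub>\<infinity>l. g k l) / csqrt (d / \<alpha>)"
    unfolding hg divide_inverse infsum_cmult_left' ..
  finally show ?thesis unfolding f_def g_def by (simp add: mult.commute)
qed

section \<open>The theta kernel of signature (1,1)\<close>

text \<open>Siegel's theta kernel for the form uv with majorant (u^2 + v^2)/2. It equals exp(2 pi i
  tau uv) exp(-pi y (u - v)^2); splitting tau into real and imaginary part exhibits the decay in
  both variables.\<close>

definition theta_kernel :: "complex \<Rightarrow> real \<Rightarrow> real \<Rightarrow> complex" where
  "theta_kernel \<tau> u v = exp (2 * of_real pi * \<i> * of_real (Re \<tau> * (u * v)) - of_real (pi * Im \<tau> * (u\<^sup>2 + v\<^sup>2)))"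

lemma norm_theta_kernel: "norm (theta_kernel \<tau> u v) = exp (- pi * Im \<tau> * (u\<^sup>2 + v\<^sup>2))"
  by (simp add: theta_kernel_def)

text \<open>The modulus is exp(-pi y |Rv|^2) for the matrix R of the \<open>r\<close>'s, and the
  Gram matrix of R has determinant (det R)^2 > 0.\<close>

lemma theta_kernel_summable:
  fixes r1 r2 r3 r4 a b :: real
  assumes \<tau>: "Im \<tau> > 0" and det: "r1 * r4 - r2 * r3 \<noteq> 0"
  shows "(\<lambda>(m::int, n::int). norm (theta_kernel \<tau> (r1 * (of_int m + a) + r2 * (of_int n + b))
    (r3 * (of_int m + a) + r4 * (of_int n + b)))) summable_on UNIV"
proof -
  define y where "y = pi * Im \<tau>"
  have y: "y > 0" using \<tau> by (simp add: y_def)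
  have "(\<lambda>(m::int, n::int). exp (- (y * (r1\<^sup>2 + r3\<^sup>2) * (of_int m + a)\<^sup>2
      + 2 * (y * (r1 * r2 + r3 * r4)) * (of_int m + a) * (of_int n + b) + y * (r2\<^sup>2 + r4\<^sup>2) * (of_int n + b)\<^sup>2)))
    summable_on UNIV"
  proof (rule summable_on_gauss_plane)
    have "r1 \<noteq> 0 \<or> r3 \<noteq> 0" using det by auto
    then show "y * (r1\<^sup>2 + r3\<^sup>2) > 0" using y by (auto simp: sum_power2_gt_zero_iff)
    have "y * (r1\<^sup>2 + r3\<^sup>2) * (y * (r2\<^sup>2 + r4\<^sup>2)) - (y * (r1 * r2 + r3 * r4))\<^sup>2 = y\<^sup>2 * (r1 * r4 - r2 * r3)\<^sup>2"
      by algebra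
    moreover have "y\<^sup>2 * (r1 * r4 - r2 * r3)\<^sup>2 > 0" using y det by simp
    ultimately show "(y * (r1 * r2 + r3 * r4))\<^sup>2 < y * (r1\<^sup>2 + r3\<^sup>2) * (y * (r2\<^sup>2 + r4\<^sup>2))" by linarith
  qed
  moreover have "norm (theta_kernel \<tau> (r1 * M + r2 * N) (r3 * M + r4 * N)) =
      exp (- (y * (r1\<^sup>2 + r3\<^sup>2) * M\<^sup>2 + 2 * (y * (r1 * r2 + r3 * r4)) * M * N + y * (r2\<^sup>2 + r4\<^sup>2) * N\<^sup>2))" for M N
    unfolding norm_theta_kernel y_def by (rule arg_cong[of _ _ exp]) algebra
  ultimately show ?thesis by simp
qed

text \<open>Both \<open>csqrt \<alpha>\<close> and \<open>E / csqrt \<alpha>\<close> lie in the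
  right half-plane, so the latter is the principal root of \<open>E\<^sup>2 / \<alpha>\<close>. This
  excludes a sign in the inversion formula.\<close>

lemma csqrt_mult_csqrt_divide:
  assumes \<alpha>: "Re \<alpha> > 0" and E: "E > 0"
  shows "csqrt \<alpha> * csqrt (of_real (E\<^sup>2) / \<alpha>) = of_real E"
proof -
  have \<alpha>0: "\<alpha> \<noteq> 0" using \<alpha> by auto
  have "Re (csqrt \<alpha>) > 0"
    using \<alpha> norm_ge_zero[of \<alpha>] by (simp add: add_nonneg_pos del: norm_ge_zero)
  then have "Re (1 / csqrt \<alpha>) > 0" by (rule Re_inverse_pos)
  then have "Re (of_real E / csqrt \<alpha>) > 0"
  proof -
    have "of_real E / csqrt \<alpha> = E *\<^sub>R (1 / csqrt \<alpha>)" by (simp add: scaleR_conv_of_real)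
    with \<open>Re (1 / csqrt \<alpha>) > 0\<close> E show ?thesis by (simp only: scaleR_complex.sel mult_pos_pos)
  qed
  then have "csqrt (of_real (E\<^sup>2) / \<alpha>) = of_real E / csqrt \<alpha>"
    by (intro csqrt_unique) (auto simp: power_divide)
  then show ?thesis using \<alpha>0 by simp
qed

lemma theta_kernel_inversion:
  fixes r1 r2 r3 r4 a1 a2 b1 b2 :: real
  assumes \<tau>: "Im \<tau> > 0"
  defines "\<delta> \<equiv> r1 * r4 - r2 * r3"
  assumes \<delta>: "\<delta> \<noteq> 0"
  shows "infsum (\<lambda>(m::int, n::int). theta_kernel (- 1 / \<tau>) (r1 * (of_int m + a1) + r2 * (of_int n + a2))
        (r3 * (of_int m + a1) + r4 * (of_int n + a2))
        * exp (2 * of_real pi * \<i> * of_real ((of_int m + a1) * b1 + (of_int n + a2) * b2))) UNIV =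
    of_real (norm \<tau> / \<bar>\<delta>\<bar>) *
    infsum (\<lambda>(k::int, l::int). theta_kernel \<tau> ((r1 * (of_int l - b2) - r2 * (of_int k - b1)) / \<delta>)
        ((r4 * (of_int k - b1) - r3 * (of_int l - b2)) / \<delta>)
        * exp (2 * of_real pi * \<i> * of_real (of_int k * a1 + of_int l * a2))) UNIV"
proof -
  define x y T where "x = Re \<tau>" and "y = Im \<tau>" and "T = (norm \<tau>)\<^sup>2"
  have \<tau>0: "\<tau> \<noteq> 0" using \<tau> by auto
  have T: "T = x\<^sup>2 + y\<^sup>2" "T > 0" using \<tau>0 by (simp_all add: T_def x_def y_def flip: cmod_power2)
  define x' y' where "x' = - x / T" and "y' = y / T"
  have xy': "Re (- 1 / \<tau>) = x'" "Im (- 1 / \<tau>) = y'"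
    by (simp_all add: Re_divide Im_divide x'_def y'_def T(1) x_def y_def)
  have y': "y' > 0" using T \<tau> by (simp add: y'_def y_def)
  have T': "x'\<^sup>2 + y'\<^sup>2 = 1 / T"
  proof -
    have "x'\<^sup>2 + y'\<^sup>2 = (x\<^sup>2 + y\<^sup>2) / T\<^sup>2"
      by (simp add: x'_def y'_def power_divide add_divide_distrib)
    also have "\<dots> = 1 / T" using T by (simp add: power2_eq_square)
    finally show ?thesis .
  qed
  \<comment> \<open>In the coordinates u, v the kernel at -1/tau has the matrix with diagonal y' and
    off-diagonal entry -ix'; \<open>A\<close>, \<open>B\<close>, \<open>C\<close> are its entries
    after the substitution by the \<open>r\<close>'s. Its determinant is x'^2 + y'^2 = 1/T, and its
    inverse is the same matrix formed for tau, since T x' = -x and T y' = y.\<close>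
  define A B C where "A = Complex (y' * (r1\<^sup>2 + r3\<^sup>2)) (- 2 * x' * (r1 * r3))"
    and "B = Complex (y' * (r1 * r2 + r3 * r4)) (- x' * (r1 * r4 + r2 * r3))"
    and "C = Complex (y' * (r2\<^sup>2 + r4\<^sup>2)) (- 2 * x' * (r2 * r4))"
  define E where "E = \<bar>\<delta>\<bar> / norm \<tau>"
  have E: "E > 0" using \<delta> \<tau>0 by (simp add: E_def)
  have E2: "E\<^sup>2 = \<delta>\<^sup>2 / T" by (simp add: E_def T_def power_divide)
  have disc: "A * C - B\<^sup>2 = of_real (E\<^sup>2)"
  proof -
    have "Re (A * C - B\<^sup>2) = \<delta>\<^sup>2 * (x'\<^sup>2 + y'\<^sup>2)"
      unfolding A_def B_def C_def \<delta>_def by (simp add: power2_eq_square) algebra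
    moreover have "Im (A * C - B\<^sup>2) = 0"
      unfolding A_def B_def C_def \<delta>_def by (simp add: power2_eq_square) algebra
    ultimately show ?thesis by (simp add: complex_eq_iff T' E2)
  qed
  have A: "Re A > 0"
  proof -
    have "r1 \<noteq> 0 \<or> r3 \<noteq> 0" using \<delta> by (auto simp: \<delta>_def)
    then show ?thesis using y' by (auto simp: A_def sum_power2_gt_zero_iff)
  qed
  have AC: "(Re B)\<^sup>2 < Re A * Re C"
  proof -
    have "Re A * Re C - (Re B)\<^sup>2 = (y' * \<delta>)\<^sup>2"
      unfolding A_def B_def C_def \<delta>_def by simp algebra
    moreover have "(y' * \<delta>)\<^sup>2 > 0" using y' \<delta> by simp
    ultimately show ?thesis by linarith
  qed
  have lhs: "theta_kernel (- 1 / \<tau>) (r1 * M + r2 * N) (r3 * M + r4 * N) * exp (2 * of_real pi * \<i> * of_real c) =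
      exp (- of_real pi * (A * of_real (M\<^sup>2) + 2 * B * of_real (M * N) + C * of_real (N\<^sup>2)) + 2 * of_real pi * \<i> * of_real c)" for M N c
  proof -
    have "2 * of_real pi * \<i> * of_real (x' * ((r1 * M + r2 * N) * (r3 * M + r4 * N)))
        - of_real (pi * y' * ((r1 * M + r2 * N)\<^sup>2 + (r3 * M + r4 * N)\<^sup>2)) =
        - of_real pi * (A * of_real (M\<^sup>2) + 2 * B * of_real (M * N) + C * of_real (N\<^sup>2))"
      unfolding complex_eq_iff A_def B_def C_def
      by (simp add: power2_eq_square algebra_simps)
    then show ?thesis unfolding theta_kernel_def xy' exp_add[symmetric] by (simp only:)
  qed
  have rhs: "exp (- of_real pi * (C * of_real (K\<^sup>2) - 2 * B * of_real (K * L) + A * of_real (L\<^sup>2)) / (A * C - B\<^sup>2) + 2 * of_real pi * \<i> * of_real c) =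
      theta_kernel \<tau> ((r1 * L - r2 * K) / \<delta>) ((r4 * K - r3 * L) / \<delta>) * exp (2 * of_real pi * \<i> * of_real c)" for K L c
  proof -
    \<comment> \<open>These are the coordinates under the inverse transpose of the matrix of the
      \<open>r\<close>'s, in exchanged order. The kernel is symmetric, but this order matches
      \<open>hyp_matrix\<close> and keeps the weight e^-t on the first coordinate once the
      \<open>r\<close>'s depend on t.\<close>
    define w1 w2 where "w1 = (r1 * L - r2 * K) / \<delta>" and "w2 = (r4 * K - r3 * L) / \<delta>"
    have K: "K = r1 * w2 + r3 * w1" and L: "L = r2 * w2 + r4 * w1"
      using \<delta> by (simp_all add: w1_def w2_def field_simps) (simp_all add: \<delta>_def algebra_simps)
    have "C * of_real (K\<^sup>2) - 2 * B * of_real (K * L) + A * of_real (L\<^sup>2) =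
        of_real (\<delta>\<^sup>2) * Complex (y' * (w1\<^sup>2 + w2\<^sup>2)) (2 * x' * (w1 * w2))"
      unfolding complex_eq_iff A_def B_def C_def K L \<delta>_def
      by (simp add: power2_eq_square) algebra
    also have "\<dots> / (A * C - B\<^sup>2) = of_real T * Complex (y' * (w1\<^sup>2 + w2\<^sup>2)) (2 * x' * (w1 * w2))"
      unfolding disc E2 using \<delta> T by simp
    also have "\<dots> = Complex (y * (w1\<^sup>2 + w2\<^sup>2)) (- 2 * x * (w1 * w2))"
      using T(2) by (simp add: complex_eq_iff x'_def y'_def)
    finally have "- of_real pi * ((C * of_real (K\<^sup>2) - 2 * B * of_real (K * L) + A * of_real (L\<^sup>2)) / (A * C - B\<^sup>2)) =
        2 * of_real pi * \<i> * of_real (x * (w1 * w2)) - of_real (pi * y * (w1\<^sup>2 + w2\<^sup>2))"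
      by (simp only:) (simp add: complex_eq_iff)
    then show ?thesis
      unfolding times_divide_eq_right
      unfolding theta_kernel_def w1_def[symmetric] w2_def[symmetric] x_def[symmetric] y_def[symmetric] exp_add[symmetric]
      by (simp only:)
  qed
  let ?g = "\<lambda>k l. theta_kernel \<tau> ((r1 * (of_int l - b2) - r2 * (of_int k - b1)) / \<delta>)
        ((r4 * (of_int k - b1) - r3 * (of_int l - b2)) / \<delta>)
        * exp (2 * of_real pi * \<i> * of_real (of_int k * a1 + of_int l * a2))"
  have gs: "(\<lambda>(k::int, l::int). ?g k l) summable_on UNIV \<times> UNIV"
  proof (rule abs_summable_summable)
    have "(- r2 / \<delta>) * (- r3 / \<delta>) - (r1 / \<delta>) * (r4 / \<delta>) = - \<delta> / \<delta>\<^sup>2"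
      by (simp add: \<delta>_def diff_divide_distrib power2_eq_square mult_ac)
    then have "(- r2 / \<delta>) * (- r3 / \<delta>) - (r1 / \<delta>) * (r4 / \<delta>) \<noteq> 0" using \<delta> by simp
    from theta_kernel_summable[OF \<tau> this, of "- b1" "- b2"]
    show "(\<lambda>x. norm (case x of (k::int, l::int) \<Rightarrow> ?g k l)) summable_on UNIV \<times> UNIV"
      by (simp add: case_prod_unfold norm_mult diff_divide_distrib)
  qed
  have "infsum (\<lambda>(m::int, n::int). theta_kernel (- 1 / \<tau>) (r1 * (of_int m + a1) + r2 * (of_int n + a2))
        (r3 * (of_int m + a1) + r4 * (of_int n + a2))
        * exp (2 * of_real pi * \<i> * of_real ((of_int m + a1) * b1 + (of_int n + a2) * b2))) UNIV =
      (\<Sum>\<^sub>\<infinity>k::int. \<Sum>\<^sub>\<infinity>l::int. ?g k l) / (csqrt A * csqrt ((A * C - B\<^sup>2) / A))"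
    unfolding lhs gauss_poisson_plane[OF A AC] rhs ..
  also have "(\<Sum>\<^sub>\<infinity>k::int. \<Sum>\<^sub>\<infinity>l::int. ?g k l) = infsum (\<lambda>(k::int, l::int). ?g k l) UNIV"
    using infsum_Sigma'_banach[OF gs] by simp
  also have "csqrt A * csqrt ((A * C - B\<^sup>2) / A) = of_real E"
    unfolding disc by (rule csqrt_mult_csqrt_divide[OF A E])
  finally show ?thesis by (simp add: E_def mult.commute)
qed

text \<open>Contains the factor q^Q as well, since only the product with the Gaussian decays. The
  sign together with \<open>min\<close> and \<open>max\<close> encodes the oriented integral by an
  unoriented one.\<close>

definition theta_integral :: "real \<Rightarrow> real \<Rightarrow> complex \<Rightarrow> real \<Rightarrow> real \<Rightarrow> complex" where
  "theta_integral t1 t2 \<tau> u v = (if t1 \<le> t2 then 1 else - 1) *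
     integral {min t1 t2..max t1 t2} (\<lambda>t. theta_kernel \<tau> (exp (- t) * u) (exp t * v))"

lemma interval_integral_continuous:
  fixes f :: "real \<Rightarrow> real"
  assumes f: "continuous_on UNIV f"
  shows "(LBINT t=ereal t1..ereal t2. f t) = (if t1 \<le> t2 then 1 else - 1) * integral {min t1 t2..max t1 t2} f"
proof -
  have *: "(LBINT t=ereal t1..ereal t2. f t) = integral {t1..t2} f" if "t1 \<le> t2" for t1 t2
    using that by (intro interval_integral_eq_integral borel_integrable_atLeastAtMost' continuous_on_subset[OF f]) auto
  show ?thesis
  proof (cases "t1 \<le> t2")
    case True
    then show ?thesis using * by (simp add: min_def max_def)
  next
    case False
    then show ?thesis
      using *[of t2 t1] interval_integral_endpoints_reverse[of "ereal t1" "ereal t2" f] by (simp add: min_def max_def)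
  qed
qed

lemma theta_integral_eq:
  "theta_integral t1 t2 \<tau> u v = exp (2 * of_real pi * \<i> * \<tau> * of_real (u * v)) *
     of_real (LBINT t=ereal t1..ereal t2. exp (- pi * Im \<tau> * (v * exp t - u * exp (- t))\<^sup>2))"
proof -
  let ?f = "\<lambda>t. exp (- pi * Im \<tau> * (v * exp t - u * exp (- t))\<^sup>2)"
  have cont: "continuous_on A ?f" for A by (intro continuous_intros)
  have kernel: "theta_kernel \<tau> (exp (- t) * u) (exp t * v) = exp (2 * of_real pi * \<i> * \<tau> * of_real (u * v)) * of_real (?f t)" for t
  proof -
    have 1: "exp (- t) * exp t = 1" by (simp add: exp_minus)
    then have 2: "(exp (- t) * u) * (exp t * v) = u * v"
      by algebra
    have 3: "(exp (- t) * u)\<^sup>2 + (exp t * v)\<^sup>2 = (v * exp t - u * exp (- t))\<^sup>2 + 2 * (u * v)"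
      using 1 by algebra
    show ?thesis
      unfolding theta_kernel_def 2 3 exp_of_real[symmetric] exp_add[symmetric]
      by (intro arg_cong[of _ _ exp]) (simp add: complex_eq_iff algebra_simps)
  qed
  have "((\<lambda>t. of_real (?f t) :: complex) has_integral of_real (integral {min t1 t2..max t1 t2} ?f)) {min t1 t2..max t1 t2}"
    by (intro has_integral_of_real integrable_integral integrable_continuous_real cont)
  then have "integral {min t1 t2..max t1 t2} (\<lambda>t. of_real (?f t) :: complex) = of_real (integral {min t1 t2..max t1 t2} ?f)"
    by (rule integral_unique)
  then show ?thesis
    unfolding theta_integral_def kernel interval_integral_continuous[OF cont] by simp
qed

lemma has_sum_theta_integral:
  fixes p1 p2 p3 p4 a b :: real and \<theta> :: "int \<times> int \<Rightarrow> complex"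
  assumes \<tau>: "Im \<tau> > 0" and det: "p1 * p4 - p2 * p3 \<noteq> 0" and \<theta>: "\<And>z. norm (\<theta> z) = 1"
  defines "U \<equiv> \<lambda>(m::int, n::int). p1 * (of_int m + a) + p2 * (of_int n + b)"
    and "V \<equiv> \<lambda>(m::int, n::int). p3 * (of_int m + a) + p4 * (of_int n + b)"
  shows "((\<lambda>z. theta_integral t1 t2 \<tau> (U z) (V z) * \<theta> z) has_sum
      (if t1 \<le> t2 then 1 else - 1) * integral {min t1 t2..max t1 t2}
        (\<lambda>t. \<Sum>\<^sub>\<infinity>z. theta_kernel \<tau> (exp (- t) * U z) (exp t * V z) * \<theta> z)) UNIV"
proof -
  let ?I = "{min t1 t2..max t1 t2}"
  define T where "T = max \<bar>t1\<bar> \<bar>t2\<bar>"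
  \<comment> \<open>For |t| \<le> \<open>T\<close> both e^(2t) and e^(-2t) are at least
    \<open>c\<close>, so the kernel at i c Im tau, without the stretching by t, dominates uniformly
    in t.\<close>
  define c where "c = exp (- 2 * T)"
  have c: "c > 0" by (simp add: c_def)
  have bound: "norm (theta_kernel \<tau> (exp (- t) * u) (exp t * v) * \<theta> z) \<le> norm (theta_kernel (\<i> * of_real (c * Im \<tau>)) u v)"
    if t: "t \<in> ?I" for t u v z
  proof -
    have "\<bar>t\<bar> \<le> T" using t by (auto simp: T_def min_def max_def split: if_splits)
    then have "c \<le> (exp (- t))\<^sup>2" "c \<le> (exp t)\<^sup>2"
      by (auto simp: c_def abs_le_iff exp_double[symmetric])
    then have "c * u\<^sup>2 + c * v\<^sup>2 \<le> (exp (- t))\<^sup>2 * u\<^sup>2 + (exp t)\<^sup>2 * v\<^sup>2"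
      by (intro add_mono mult_right_mono) auto
    then have "pi * Im \<tau> * (c * u\<^sup>2 + c * v\<^sup>2) \<le> pi * Im \<tau> * ((exp (- t) * u)\<^sup>2 + (exp t * v)\<^sup>2)"
      using \<tau> by (intro mult_left_mono) (auto simp: power_mult_distrib)
    then show ?thesis
      by (simp add: norm_mult \<theta> norm_theta_kernel algebra_simps)
  qed
  have "((\<lambda>z. integral ?I (\<lambda>t. theta_kernel \<tau> (exp (- t) * U z) (exp t * V z) * \<theta> z)) has_sum
      integral ?I (\<lambda>t. \<Sum>\<^sub>\<infinity>z. theta_kernel \<tau> (exp (- t) * U z) (exp t * V z) * \<theta> z)) UNIV"
  proof (rule has_sum_integral_interval)
    show "continuous_on ?I (\<lambda>t. theta_kernel \<tau> (exp (- t) * U z) (exp t * V z) * \<theta> z)" for z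
      unfolding theta_kernel_def by (intro continuous_intros)
    show "norm (theta_kernel \<tau> (exp (- t) * U z) (exp t * V z) * \<theta> z) \<le> norm (theta_kernel (\<i> * of_real (c * Im \<tau>)) (U z) (V z))"
      if "t \<in> ?I" for z t
      by (rule bound[OF that])
    show "(\<lambda>z. norm (theta_kernel (\<i> * of_real (c * Im \<tau>)) (U z) (V z))) summable_on UNIV"
      using theta_kernel_summable[OF _ det, of "\<i> * of_real (c * Im \<tau>)" a b] c \<tau>
      by (simp add: U_def V_def case_prod_unfold)
  qed
  from has_sum_cmult_right[OF this, of "if t1 \<le> t2 then 1 else - 1"] show ?thesis
    by (simp add: theta_integral_def mult.assoc)
qed

text \<open>Stretching the rows by e^-t and e^t preserves the determinant, so the factor in the
  pointwise inversion does not depend on t and leaves the integral. Summability of \<open>f\<close>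
  is recorded for splitting the dual sum into cosets.\<close>

lemma theta_integral_inversion:
  fixes p1 p2 p3 p4 a1 a2 b1 b2 t1 t2 :: real
  assumes \<tau>: "Im \<tau> > 0"
  defines "\<delta> \<equiv> p1 * p4 - p2 * p3"
  assumes \<delta>: "\<delta> \<noteq> 0"
  defines "f \<equiv> \<lambda>(k::int, l::int). theta_integral t1 t2 \<tau> ((p1 * (of_int l - b2) - p2 * (of_int k - b1)) / \<delta>)
        ((p4 * (of_int k - b1) - p3 * (of_int l - b2)) / \<delta>)
        * exp (2 * of_real pi * \<i> * of_real (of_int k * a1 + of_int l * a2))"
  shows "infsum (\<lambda>(m::int, n::int). theta_integral t1 t2 (- 1 / \<tau>) (p1 * (of_int m + a1) + p2 * (of_int n + a2))
        (p3 * (of_int m + a1) + p4 * (of_int n + a2))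
        * exp (2 * of_real pi * \<i> * of_real ((of_int m + a1) * b1 + (of_int n + a2) * b2))) UNIV =
    of_real (norm \<tau> / \<bar>\<delta>\<bar>) * infsum f UNIV"
    and "f summable_on UNIV"
proof -
  let ?s = "if t1 \<le> t2 then 1 else (- 1 :: complex)" and ?I = "{min t1 t2..max t1 t2}"
  have \<tau>': "Im (- 1 / \<tau>) > 0"
    using \<tau> by (simp add: Im_divide) (metis less_numeral_extra(3) sum_power2_gt_zero_iff divide_pos_pos)
  have det': "(- p2 / \<delta>) * (- p3 / \<delta>) - (p1 / \<delta>) * (p4 / \<delta>) \<noteq> 0"
  proof -
    have "(- p2 / \<delta>) * (- p3 / \<delta>) - (p1 / \<delta>) * (p4 / \<delta>) = - \<delta> / \<delta>\<^sup>2"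
      by (simp add: \<delta>_def diff_divide_distrib power2_eq_square mult_ac)
    then show ?thesis using \<delta> by simp
  qed
  have f: "(f has_sum ?s * integral ?I (\<lambda>t. infsum (\<lambda>(k::int, l::int).
      theta_kernel \<tau> (exp (- t) * ((p1 * (of_int l - b2) - p2 * (of_int k - b1)) / \<delta>))
        (exp t * ((p4 * (of_int k - b1) - p3 * (of_int l - b2)) / \<delta>))
        * exp (2 * of_real pi * \<i> * of_real (of_int k * a1 + of_int l * a2))) UNIV)) UNIV"
    using has_sum_theta_integral[OF \<tau> det', of "\<lambda>(k, l). exp (2 * of_real pi * \<i> * of_real (of_int k * a1 + of_int l * a2))" t1 t2 "- b1" "- b2"]
    by (simp add: f_def case_prod_unfold diff_divide_distrib)
  then show "f summable_on UNIV" by (rule has_sum_imp_summable)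
  have inv: "infsum (\<lambda>(m::int, n::int). theta_kernel (- 1 / \<tau>) (exp (- t) * (p1 * (of_int m + a1) + p2 * (of_int n + a2)))
        (exp t * (p3 * (of_int m + a1) + p4 * (of_int n + a2)))
        * exp (2 * of_real pi * \<i> * of_real ((of_int m + a1) * b1 + (of_int n + a2) * b2))) UNIV =
      of_real (norm \<tau> / \<bar>\<delta>\<bar>) * infsum (\<lambda>(k::int, l::int).
        theta_kernel \<tau> (exp (- t) * ((p1 * (of_int l - b2) - p2 * (of_int k - b1)) / \<delta>))
        (exp t * ((p4 * (of_int k - b1) - p3 * (of_int l - b2)) / \<delta>))
        * exp (2 * of_real pi * \<i> * of_real (of_int k * a1 + of_int l * a2))) UNIV" for t
  proof -
    have 1: "exp (- t) * exp t = 1" by (simp add: exp_minus)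
    then have d: "(exp (- t) * p1) * (exp t * p4) - (exp (- t) * p2) * (exp t * p3) = \<delta>"
      unfolding \<delta>_def by algebra
    show ?thesis
      using theta_kernel_inversion[OF \<tau>, of "exp (- t) * p1" "exp t * p4" "exp (- t) * p2" "exp t * p3" a1 a2 b1 b2] \<delta>
      unfolding d by (simp add: distrib_left right_diff_distrib mult.assoc)
  qed
  have "((\<lambda>(m::int, n::int). theta_integral t1 t2 (- 1 / \<tau>) (p1 * (of_int m + a1) + p2 * (of_int n + a2))
        (p3 * (of_int m + a1) + p4 * (of_int n + a2))
        * exp (2 * of_real pi * \<i> * of_real ((of_int m + a1) * b1 + (of_int n + a2) * b2))) has_sum
      ?s * integral ?I (\<lambda>t. infsum (\<lambda>(m::int, n::int). theta_kernel (- 1 / \<tau>) (exp (- t) * (p1 * (of_int m + a1) + p2 * (of_int n + a2)))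
        (exp t * (p3 * (of_int m + a1) + p4 * (of_int n + a2)))
        * exp (2 * of_real pi * \<i> * of_real ((of_int m + a1) * b1 + (of_int n + a2) * b2))) UNIV)) UNIV"
    using has_sum_theta_integral[OF \<tau>' \<delta>[unfolded \<delta>_def], of "\<lambda>(m, n). exp (2 * of_real pi * \<i> * of_real ((of_int m + a1) * b1 + (of_int n + a2) * b2))" t1 t2 a1 a2]
    by (simp add: case_prod_unfold)
  then show "infsum (\<lambda>(m::int, n::int). theta_integral t1 t2 (- 1 / \<tau>) (p1 * (of_int m + a1) + p2 * (of_int n + a2))
        (p3 * (of_int m + a1) + p4 * (of_int n + a2))
        * exp (2 * of_real pi * \<i> * of_real ((of_int m + a1) * b1 + (of_int n + a2) * b2))) UNIV =
    of_real (norm \<tau> / \<bar>\<delta>\<bar>) * infsum f UNIV"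
    unfolding inv infsumI[OF f] by (simp add: infsumI mult.left_commute)
qed

section \<open>Transformation laws\<close>

lemma matrix_inv_mult_vector:
  fixes M :: "real^'n^'n"
  assumes "invertible M"
  shows "M *v (matrix_inv M *v w) = w" and "matrix_inv M *v (M *v w) = w"
  using someI_ex[OF assms[unfolded invertible_def]]
  by (simp_all add: matrix_vector_mul_assoc matrix_inv_def)

lemma mult_vector_2:
  fixes M :: "real^2^2"
  shows "(M *v v) $ i = M $ i $ 1 * v $ 1 + M $ i $ 2 * v $ 2"
  by (simp add: matrix_vector_mult_def sum_2)

lemma hyp_form_entries:
  fixes A P :: "real^2^2"
  assumes "A = transpose P ** hyp_matrix ** P"
  shows "A $ i $ j = P $ 1 $ i * P $ 2 $ j + P $ 2 $ i * P $ 1 $ j"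
  unfolding assms by (simp add: matrix_matrix_mult_def transpose_def hyp_matrix_def sum_2 algebra_simps)

lemma bil_form_hyp:
  fixes A P :: "real^2^2"
  assumes "A = transpose P ** hyp_matrix ** P"
  shows "bil_form A v w = (P *v v) $ 1 * (P *v w) $ 2 + (P *v v) $ 2 * (P *v w) $ 1"
  by (simp add: bil_form_def inner_vec_def sum_2 mult_vector_2 hyp_form_entries[OF assms] algebra_simps)

lemma bil_form_c_curve:
  assumes "invertible P" and "A = transpose P ** hyp_matrix ** P"
  shows "bil_form A v (c_curve P t) = (P *v v) $ 2 * exp t - (P *v v) $ 1 * exp (- t)"
  unfolding bil_form_hyp[OF assms(2)] c_curve_def matrix_inv_mult_vector(1)[OF assms(1)] by simp

lemma bil_form_add_left: "bil_form A (u + v) w = bil_form A u w + bil_form A v w"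
  by (simp add: bil_form_def inner_add_left)

lemma bil_form_add_right: "bil_form A u (v + w) = bil_form A u v + bil_form A u w"
  by (simp add: bil_form_def inner_add_right matrix_vector_right_distrib)

lemma bil_form_sym:
  assumes "transpose A = A"
  shows "bil_form A v w = bil_form A w v"
  using assms by (metis bil_form_def dot_lmul_matrix inner_commute transpose_matrix_vector)

lemma int_lattice_add: "u \<in> int_lattice \<Longrightarrow> v \<in> int_lattice \<Longrightarrow> u + v \<in> int_lattice"
  by (simp add: int_lattice_def)

lemma int_lattice_diff: "u \<in> int_lattice \<Longrightarrow> v \<in> int_lattice \<Longrightarrow> u - v \<in> int_lattice"
  by (simp add: int_lattice_def)

lemma int_lattice_uminus: "u \<in> int_lattice \<Longrightarrow> - u \<in> int_lattice"
  by (simp add: int_lattice_def)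

lemma inner_int_lattice:
  fixes u v :: "real^'n"
  shows "u \<in> int_lattice \<Longrightarrow> v \<in> int_lattice \<Longrightarrow> u \<bullet> v \<in> \<int>"
  by (auto simp: int_lattice_def inner_vec_def)

lemma dual_lattice_iff:
  fixes A :: "real^'n^'n"
  assumes "invertible A"
  shows "v \<in> dual_lattice A \<longleftrightarrow> A *v v \<in> int_lattice"
proof
  assume "v \<in> dual_lattice A"
  then show "A *v v \<in> int_lattice"
    by (auto simp: dual_lattice_def matrix_inv_mult_vector(1)[OF assms])
next
  assume "A *v v \<in> int_lattice"
  then show "v \<in> dual_lattice A"
    unfolding dual_lattice_def by (intro image_eqI[of _ _ "A *v v"]) (simp_all add: matrix_inv_mult_vector(2)[OF assms])
qed

lemma mult_int_lattice:
  fixes A :: "real^'n^'n"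
  assumes "\<forall>i j. A $ i $ j \<in> \<int>" and "v \<in> int_lattice"
  shows "A *v v \<in> int_lattice"
  using assms by (auto simp: int_lattice_def matrix_vector_mult_def)

lemma exp_2pi_i_Ints:
  assumes "x \<in> \<int>"
  shows "exp (2 * of_real pi * \<i> * of_real x) = (1 :: complex)"
  using assms by (auto elim!: Ints_cases simp: exp_eq_1)

lemma exp_2pi_i_add:
  "exp (2 * of_real pi * \<i> * of_real (x + y)) = exp (2 * of_real pi * \<i> * of_real x) * exp (2 * of_real pi * \<i> * (of_real y :: complex))"
  by (simp add: exp_add[symmetric] distrib_left)

definition int_vec :: "int \<times> int \<Rightarrow> real^2" where
  "int_vec z = vector [of_int (fst z), of_int (snd z)]"

lemma int_vec_nth [simp]: "int_vec z $ 1 = of_int (fst z)" "int_vec z $ 2 = of_int (snd z)"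
  by (simp_all add: int_vec_def)

lemma bij_int_vec: "bij_betw int_vec UNIV int_lattice"
proof (rule bij_betwI')
  show "int_vec x = int_vec y \<longleftrightarrow> x = y" for x y
    by (auto simp: vec_eq_iff forall_2 prod_eq_iff)
  show "int_vec x \<in> int_lattice" for x
    by (simp add: int_lattice_def forall_2)
  show "\<exists>x\<in>UNIV. v = int_vec x" if "v \<in> int_lattice" for v
  proof -
    from that have "v $ 1 \<in> \<int>" "v $ 2 \<in> \<int>" by (simp_all add: int_lattice_def)
    then obtain m n where "v $ 1 = of_int m" "v $ 2 = of_int n" by (auto elim!: Ints_cases)
    then have "v = int_vec (m, n)" by (simp add: vec_eq_iff forall_2)
    then show ?thesis by blast
  qed
qed

text \<open>The coset of r is determined by the integer vector A r modulo D = det A: if A(r - s) = D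
  k with k integral, then r - s is the adjugate of \<open>A\<close> applied to k, hence
  integral.\<close>

lemma finite_coset_reps:
  fixes A :: "real^2^2"
  assumes int: "\<forall>i j. A $ i $ j \<in> \<int>" and inv: "invertible A"
    and R: "coset_reps (dual_lattice A) int_lattice R"
  shows "finite R"
proof -
  have "det A \<in> \<int>" unfolding det_2 using int by simp
  then obtain D where D: "det A = of_int D" by (rule Ints_cases)
  have D0: "D \<noteq> 0" using inv D by (auto simp: invertible_det_nz)
  define N where "N = (\<lambda>r i. \<lfloor>(A *v r) $ i\<rfloor>)"
  define \<phi> where "\<phi> = (\<lambda>r. (N r 1 mod D, N r 2 mod D))"
  have inj: "inj_on \<phi> R"
  proof (rule inj_onI)
    fix r s assume r: "r \<in> R" and s: "s \<in> R" and eq: "\<phi> r = \<phi> s"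
    have rd: "r \<in> dual_lattice A" and sd: "s \<in> dual_lattice A" using r s R by (auto simp: coset_reps_def)
    have N: "(A *v r) $ i = of_int (N r i)" if "r \<in> dual_lattice A" for r i
      using that unfolding dual_lattice_iff[OF inv] int_lattice_def N_def by (auto elim!: Ints_cases)
    have "D dvd N r i - N s i" for i
      using eq exhaust_2[of i] by (auto simp: \<phi>_def mod_eq_dvd_iff)
    then obtain k where k: "\<And>i. N r i - N s i = D * k i" unfolding dvd_def by metis
    have Ak: "A *v (r - s) = det A *\<^sub>R (\<chi> i. of_int (k i))"
      by (simp add: vec_eq_iff matrix_vector_mult_diff_distrib N[OF rd] N[OF sd] D k flip: of_int_diff of_int_mult)
    have d0: "det A \<noteq> 0" using D D0 by simp
    define w where "w = r - s"
    have w: "A$1$1 * w$1 + A$1$2 * w$2 = det A * of_int (k 1)" "A$2$1 * w$1 + A$2$2 * w$2 = det A * of_int (k 2)"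
      using Ak by (simp_all add: vec_eq_iff forall_2 mult_vector_2 w_def)
    have "det A * w $ 1 = det A * (A$2$2 * of_int (k 1) - A$1$2 * of_int (k 2))"
      using w unfolding det_2 by algebra
    moreover have "det A * w $ 2 = det A * (A$1$1 * of_int (k 2) - A$2$1 * of_int (k 1))"
      using w unfolding det_2 by algebra
    ultimately have "w $ 1 = A$2$2 * of_int (k 1) - A$1$2 * of_int (k 2)" "w $ 2 = A$1$1 * of_int (k 2) - A$2$1 * of_int (k 1)"
      using d0 by simp_all
    then have "w \<in> int_lattice" using int by (simp add: int_lattice_def forall_2)
    moreover have "(0 :: real^2) \<in> int_lattice" by (simp add: int_lattice_def)
    ultimately show "r = s"
      using R r s rd unfolding coset_reps_def w_def by (metis diff_self)
  qed
  \<comment> \<open>The symmetric box covers both signs of \<open>D\<close>, since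
    \<open>mod\<close> takes the sign of the divisor.\<close>
  have "\<phi> ` R \<subseteq> {- \<bar>D\<bar>..\<bar>D\<bar>} \<times> {- \<bar>D\<bar>..\<bar>D\<bar>}"
  proof -
    have "n mod D \<in> {- \<bar>D\<bar>..\<bar>D\<bar>}" for n
    proof (cases "D > 0")
      case True
      then show ?thesis using pos_mod_bound[of D n] pos_mod_sign[of D n] by (simp del: pos_mod_bound pos_mod_sign)
    next
      case False
      then show ?thesis
        using D0 neg_mod_bound[of D n] neg_mod_sign[of D n] by (simp del: neg_mod_bound neg_mod_sign)
    qed
    then show ?thesis by (auto simp: \<phi>_def simp del: atLeastAtMost_iff)
  qed
  then have "finite (\<phi> ` R)" by (rule finite_subset) simp
  then show ?thesis using inj by (rule finite_imageD)
qed

section \<open>The transformation laws, one by one\<close>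

lemma Phi_hat_eq_theta_integral:
  assumes "invertible P" and "A = transpose P ** hyp_matrix ** P"
  shows "Phi_hat A P c1 c2 a b \<tau> = of_real (sqrt (Im \<tau>)) * (\<Sum>\<^sub>\<infinity>v\<in>(\<lambda>n. a + n) ` int_lattice.
      theta_integral (t_param P c1) (t_param P c2) \<tau> ((P *v v) $ 1) ((P *v v) $ 2) *
      exp (2 * of_real pi * \<i> * of_real (bil_form A v b)))"
  unfolding Phi_hat_def theta_integral_eq quad_form_hyp[OF assms(2)] bil_form_c_curve[OF assms]
  by (simp only: mult_ac)

lemma translate_int_lattice:
  assumes "l \<in> int_lattice"
  shows "(\<lambda>n. a + l + n) ` int_lattice = (\<lambda>n. a + n) ` int_lattice"
proof (intro equalityI subsetI)
  fix x assume "x \<in> (\<lambda>n. a + l + n) ` int_lattice"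
  then show "x \<in> (\<lambda>n. a + n) ` int_lattice"
    using int_lattice_add[OF assms] by (auto simp: add.assoc)
next
  fix x assume "x \<in> (\<lambda>n. a + n) ` int_lattice"
  then obtain n where "n \<in> int_lattice" "x = a + l + (n - l)" by auto
  then show "x \<in> (\<lambda>n. a + l + n) ` int_lattice"
    using int_lattice_diff[OF _ assms] by blast
qed

text \<open>The index set sees \<open>a\<close> only modulo the integer lattice, and B(n, m) is an
  integer for integral n because A m is integral.\<close>

lemma Phi_hat_translate:
  assumes P: "invertible P" "A = transpose P ** hyp_matrix ** P" and A: "invertible A"
    and l: "l \<in> int_lattice" and m: "m \<in> dual_lattice A"
  shows "Phi_hat A P c1 c2 (a + l) (b + m) \<tau> =
    exp (2 * of_real pi * \<i> * of_real (bil_form A a m)) * Phi_hat A P c1 c2 a b \<tau>"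
proof -
  let ?F = "\<lambda>v. theta_integral (t_param P c1) (t_param P c2) \<tau> ((P *v v) $ 1) ((P *v v) $ 2)"
  have "(\<Sum>\<^sub>\<infinity>v\<in>(\<lambda>n. a + n) ` int_lattice. ?F v * exp (2 * of_real pi * \<i> * of_real (bil_form A v (b + m)))) =
    (\<Sum>\<^sub>\<infinity>v\<in>(\<lambda>n. a + n) ` int_lattice. exp (2 * of_real pi * \<i> * of_real (bil_form A a m)) *
      (?F v * exp (2 * of_real pi * \<i> * of_real (bil_form A v b))))"
  proof (rule infsum_cong)
    fix v assume "v \<in> (\<lambda>n. a + n) ` int_lattice"
    then obtain n where n: "n \<in> int_lattice" "v = a + n" by blast
    have "bil_form A n m \<in> \<int>"
      unfolding bil_form_def using m n by (intro inner_int_lattice) (auto simp: dual_lattice_iff[OF A])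
    then have "exp (2 * of_real pi * \<i> * of_real (bil_form A v (b + m))) =
        exp (2 * of_real pi * \<i> * of_real (bil_form A a m)) * exp (2 * of_real pi * \<i> * of_real (bil_form A v b))"
      unfolding bil_form_add_right exp_2pi_i_add n(2) bil_form_add_left[of A a n m] by (simp add: exp_2pi_i_Ints)
    then show "?F v * exp (2 * of_real pi * \<i> * of_real (bil_form A v (b + m))) =
        exp (2 * of_real pi * \<i> * of_real (bil_form A a m)) * (?F v * exp (2 * of_real pi * \<i> * of_real (bil_form A v b)))"
      by (simp only: mult_ac)
  qed
  then show ?thesis
    unfolding Phi_hat_eq_theta_integral[OF P] translate_int_lattice[OF l] infsum_cmult_right' by (simp only: mult_ac)
qed

lemma Phi_hat_uminus:
  assumes P: "invertible P" "A = transpose P ** hyp_matrix ** P"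
  shows "Phi_hat A P c1 c2 (- a) (- b) \<tau> = Phi_hat A P c1 c2 a b \<tau>"
proof -
  let ?F = "\<lambda>v. theta_integral (t_param P c1) (t_param P c2) \<tau> ((P *v v) $ 1) ((P *v v) $ 2)"
  have P_uminus: "(P *v (- v)) $ i = - ((P *v v) $ i)" for v i
    by (simp add: mult_vector_2)
  have even: "?F (- v) = ?F v" for v
    unfolding P_uminus theta_integral_def theta_kernel_def by simp
  have "(\<Sum>\<^sub>\<infinity>v\<in>(\<lambda>n. - a + n) ` int_lattice. ?F v * exp (2 * of_real pi * \<i> * of_real (bil_form A v (- b)))) =
    (\<Sum>\<^sub>\<infinity>v\<in>(\<lambda>n. a + n) ` int_lattice. ?F v * exp (2 * of_real pi * \<i> * of_real (bil_form A v b)))"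
  proof (rule infsum_reindex_bij_witness[of _ uminus uminus])
    show "- v \<in> (\<lambda>n. a + n) ` int_lattice" if v: "v \<in> (\<lambda>n. - a + n) ` int_lattice" for v
    proof -
      from v obtain n where "n \<in> int_lattice" "- v = a + - n" by auto
      then show ?thesis using int_lattice_uminus by blast
    qed
    show "- v \<in> (\<lambda>n. - a + n) ` int_lattice" if v: "v \<in> (\<lambda>n. a + n) ` int_lattice" for v
    proof -
      from v obtain n where "n \<in> int_lattice" "- v = - a + - n" by auto
      then show ?thesis using int_lattice_uminus by blast
    qed
    show "?F (- v) * exp (2 * of_real pi * \<i> * of_real (bil_form A (- v) b)) =
        ?F v * exp (2 * of_real pi * \<i> * of_real (bil_form A v (- b)))" for v
      unfolding even unfolding bil_form_hyp[OF P(2)] P_uminus by simp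
  qed auto
  then show ?thesis unfolding Phi_hat_eq_theta_integral[OF P] by simp
qed

text \<open>Since k(k - 1) is even, half of A_ii n_i^2 is congruent to half of A_ii n_i modulo 1.
  This is where the vector \<open>diag_vec A\<close> comes from.\<close>

lemma quad_form_cong_half_diag:
  fixes A :: "real^2^2"
  assumes sym: "transpose A = A" and int: "\<forall>i j. A $ i $ j \<in> \<int>" and n: "n \<in> int_lattice"
  shows "quad_form A n - 1/2 * (diag_vec A \<bullet> n) \<in> \<int>"
proof -
  have "A $ 2 $ 1 = A $ 1 $ 2" using arg_cong[OF sym, of "\<lambda>M. M $ 1 $ 2"] by (simp add: transpose_def)
  then have eq: "quad_form A n - 1/2 * (diag_vec A \<bullet> n) =
      A$1$1 * (n$1 * (n$1 - 1) / 2) + A$2$2 * (n$2 * (n$2 - 1) / 2) + A$1$2 * n$1 * n$2"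
    by (simp add: quad_form_def diag_vec_def inner_vec_def sum_2 mult_vector_2 field_simps)
  have tri: "x * (x - 1) / 2 \<in> \<int>" if x: "x \<in> \<int>" for x :: real
  proof -
    from x obtain k where k: "x = of_int k" by (auto elim!: Ints_cases)
    have "even (k * (k - 1))" by simp
    then obtain j where "k * (k - 1) = 2 * j" by blast
    then have "x * (x - 1) = 2 * of_int j" unfolding k by (metis of_int_1 of_int_diff of_int_mult of_int_numeral)
    then show ?thesis by simp
  qed
  show ?thesis
    unfolding eq using int n by (intro Ints_add Ints_mult tri) (simp_all add: int_lattice_def)
qed

lemma Phi_hat_plus_1:
  fixes A P :: "real^2^2"
  assumes sym: "transpose A = A" and int: "\<forall>i j. A $ i $ j \<in> \<int>"
    and P: "invertible P" "A = transpose P ** hyp_matrix ** P" and A: "invertible A"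
  shows "Phi_hat A P c1 c2 a b (\<tau> + 1) =
    exp (- 2 * of_real pi * \<i> * of_real (quad_form A a)
         - of_real pi * \<i> * of_real (bil_form A (matrix_inv A *v diag_vec A) a)) *
    Phi_hat A P c1 c2 a (a + b + (1/2) *\<^sub>R (matrix_inv A *v diag_vec A)) \<tau>"
proof -
  let ?F = "\<lambda>\<tau> v. theta_integral (t_param P c1) (t_param P c2) \<tau> ((P *v v) $ 1) ((P *v v) $ 2)"
  let ?d = "matrix_inv A *v diag_vec A"
  let ?e = "\<lambda>x. exp (2 * of_real pi * \<i> * of_real x) :: complex"
  have shift: "?F (\<tau> + 1) v = ?F \<tau> v * ?e (quad_form A v)" for v
    unfolding theta_integral_eq quad_form_hyp[OF P(2)] by (simp add: distrib_left distrib_right exp_add)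
  have "(\<Sum>\<^sub>\<infinity>v\<in>(\<lambda>n. a + n) ` int_lattice. ?F (\<tau> + 1) v * ?e (bil_form A v b)) =
    (\<Sum>\<^sub>\<infinity>v\<in>(\<lambda>n. a + n) ` int_lattice. ?e (- quad_form A a - 1/2 * bil_form A ?d a) *
      (?F \<tau> v * ?e (bil_form A v (a + b + (1/2) *\<^sub>R ?d))))"
  proof (rule infsum_cong)
    fix v assume "v \<in> (\<lambda>n. a + n) ` int_lattice"
    then obtain n where n: "n \<in> int_lattice" "v = a + n" by blast
    have d: "bil_form A u ?d = diag_vec A \<bullet> u" for u
      unfolding bil_form_def matrix_inv_mult_vector(1)[OF A] by (rule inner_commute)
    have d2: "bil_form A u ((1/2) *\<^sub>R ?d) = 1/2 * (diag_vec A \<bullet> u)" for u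
      unfolding d[symmetric] by (simp add: bil_form_def matrix_vector_mult_scaleR)
    have q: "quad_form A v = quad_form A a + bil_form A n a + quad_form A n"
      using bil_form_sym[OF sym, of n a]
      by (simp add: quad_form_def n(2) bil_form_def[symmetric] bil_form_add_left bil_form_add_right)
    have aa: "bil_form A a a = 2 * quad_form A a" by (simp add: quad_form_def bil_form_def)
    \<comment> \<open>Modulo 1, Q(n) is half of B(n, d) with d the vector \<open>?d\<close>.
      Rewriting n as v - a turns Q(v) into B(v, a + d/2) minus terms in \<open>a\<close> alone;
      B(a,a) = 2 Q(a) explains the sign of Q(a).\<close>
    have "quad_form A v + bil_form A v b =
        (quad_form A n - 1/2 * (diag_vec A \<bullet> n)) +
        ((- quad_form A a - 1/2 * bil_form A ?d a) + bil_form A v (a + b + (1/2) *\<^sub>R ?d))"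
      unfolding q bil_form_add_right d2 bil_form_sym[OF sym, of ?d a] d
      unfolding n(2) bil_form_add_left aa inner_add_right by (simp add: field_simps)
    then have *: "?e (quad_form A v) * ?e (bil_form A v b) =
        ?e (- quad_form A a - 1/2 * bil_form A ?d a) * ?e (bil_form A v (a + b + (1/2) *\<^sub>R ?d))"
      unfolding exp_2pi_i_add[symmetric]
      by (simp only: exp_2pi_i_add[of "quad_form A n - 1/2 * (diag_vec A \<bullet> n)"] exp_2pi_i_Ints[OF quad_form_cong_half_diag[OF sym int n(1)]] mult_1_left)
    then show "?F (\<tau> + 1) v * ?e (bil_form A v b) = ?e (- quad_form A a - 1/2 * bil_form A ?d a) *
        (?F \<tau> v * ?e (bil_form A v (a + b + (1/2) *\<^sub>R ?d)))"
      unfolding shift by (simp only: mult.assoc *) (simp only: mult.left_commute)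
  qed
  moreover have "?e (- quad_form A a - 1/2 * bil_form A ?d a) =
      exp (- 2 * of_real pi * \<i> * of_real (quad_form A a) - of_real pi * \<i> * of_real (bil_form A ?d a))"
    by (rule arg_cong[of _ _ exp]) (simp add: algebra_simps)
  ultimately show ?thesis
    unfolding Phi_hat_eq_theta_integral[OF P] infsum_cmult_right' by (simp add: mult_ac)
qed

lemma det_hyp_form:
  fixes A P :: "real^2^2"
  assumes "A = transpose P ** hyp_matrix ** P"
  shows "det A = - (det P)\<^sup>2"
  unfolding det_2 hyp_form_entries[OF assms] by algebra

text \<open>Integrality of \<open>A\<close> puts the integer lattice inside the dual one; existence
  of a representative gives the covering and its uniqueness the disjointness.\<close>

lemma dual_lattice_coset_decomposition:
  fixes A :: "real^2^2"
  assumes int: "\<forall>i j. A $ i $ j \<in> \<int>" and A: "invertible A"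
    and R: "coset_reps (dual_lattice A) int_lattice R"
  shows "(\<Union>p\<in>R. (\<lambda>n. - b + p + n) ` int_lattice) = (\<lambda>d. d - b) ` dual_lattice A"
    and "\<lbrakk>p \<in> R; p' \<in> R; p \<noteq> p'\<rbrakk> \<Longrightarrow>
      (\<lambda>n. - b + p + n) ` int_lattice \<inter> (\<lambda>n. - b + p' + n) ` int_lattice = {}"
proof -
  have R_sub: "R \<subseteq> dual_lattice A" and R_ex1: "\<And>d. d \<in> dual_lattice A \<Longrightarrow> \<exists>!r. r \<in> R \<and> d - r \<in> int_lattice"
    using R by (auto simp: coset_reps_def)
  show "(\<Union>p\<in>R. (\<lambda>n. - b + p + n) ` int_lattice) = (\<lambda>d. d - b) ` dual_lattice A"
  proof (intro equalityI subsetI)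
    fix x assume "x \<in> (\<Union>p\<in>R. (\<lambda>n. - b + p + n) ` int_lattice)"
    then obtain p n where "p \<in> R" "n \<in> int_lattice" and x: "x = - b + p + n" by blast
    then have "A *v p \<in> int_lattice" "A *v n \<in> int_lattice"
      using R_sub dual_lattice_iff[OF A] mult_int_lattice[OF int] by auto
    then have "p + n \<in> dual_lattice A"
      by (simp add: dual_lattice_iff[OF A] matrix_vector_right_distrib int_lattice_add)
    moreover have "x = (p + n) - b" using x by simp
    ultimately show "x \<in> (\<lambda>d. d - b) ` dual_lattice A" by blast
  next
    fix x assume "x \<in> (\<lambda>d. d - b) ` dual_lattice A"
    then obtain d where d: "d \<in> dual_lattice A" "x = d - b" by blast
    then obtain r where r: "r \<in> R" "d - r \<in> int_lattice" using R_ex1 by blast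
    have "x = - b + r + (d - r)" using d by simp
    with r show "x \<in> (\<Union>p\<in>R. (\<lambda>n. - b + p + n) ` int_lattice)" by blast
  qed
  show "(\<lambda>n. - b + p + n) ` int_lattice \<inter> (\<lambda>n. - b + p' + n) ` int_lattice = {}"
    if p: "p \<in> R" "p' \<in> R" "p \<noteq> p'"
  proof (rule ccontr)
    assume "\<not> ?thesis"
    then obtain n n' where n: "n \<in> int_lattice" "n' \<in> int_lattice" and "- b + p + n = - b + p' + n'" by blast
    then have "p - p' = n' - n" by (simp add: algebra_simps)
    then have "p - p' \<in> int_lattice" using n by (simp add: int_lattice_diff)
    moreover have "p - p \<in> int_lattice" by (simp add: int_lattice_def)
    ultimately show False using R_ex1[of p] p R_sub by blast
  qed
qed

lemma Phi_hat_inversion: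
  fixes A P :: "real^2^2"
  assumes sym: "transpose A = A" and int: "\<forall>i j. A $ i $ j \<in> \<int>"
    and P: "invertible P" "A = transpose P ** hyp_matrix ** P" and A: "invertible A"
    and \<tau>: "Im \<tau> > 0" and R: "coset_reps (dual_lattice A) int_lattice R"
  shows "Phi_hat A P c1 c2 a b (- 1 / \<tau>) =
    exp (2 * of_real pi * \<i> * of_real (bil_form A a b)) / of_real (sqrt (- det A)) *
    (\<Sum>p\<in>R. Phi_hat A P c1 c2 (- b + p) a \<tau>)"
proof -
  let ?T = "theta_integral (t_param P c1) (t_param P c2)"
  let ?F = "\<lambda>\<tau> v. ?T \<tau> ((P *v v) $ 1) ((P *v v) $ 2)"
  let ?e = "\<lambda>x. exp (2 * of_real pi * \<i> * of_real x) :: complex"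
  define \<delta> where "\<delta> = P$1$1 * P$2$2 - P$1$2 * P$2$1"
  have \<delta>: "\<delta> \<noteq> 0" using P(1) by (simp add: invertible_det_nz det_2 \<delta>_def)
  \<comment> \<open>With this vector B(v, b) is the ordinary inner product of v and
    \<open>\<beta>\<close>, the form of character in the planar formula.\<close>
  define \<beta> where "\<beta> = A *v b"
  define f where "f = (\<lambda>(k::int, l::int). ?T \<tau> ((P$1$1 * (of_int l - \<beta>$2) - P$1$2 * (of_int k - \<beta>$1)) / \<delta>)
        ((P$2$2 * (of_int k - \<beta>$1) - P$2$1 * (of_int l - \<beta>$2)) / \<delta>) * ?e (of_int k * a$1 + of_int l * a$2))"
  \<comment> \<open>The frequency (k, l) shifted by \<open>\<beta>\<close> equals A applied to
    \<open>V z\<close>, so \<open>V\<close> identifies the frequencies with the translate by -b of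
    the dual lattice. Its inner product with \<open>a\<close> is B(a,b) + B(V z, a), the source of
    the prefactor.\<close>
  define V where "V = (\<lambda>z. matrix_inv A *v int_vec z - b)"
  define g where "g = (\<lambda>v. ?F \<tau> v * ?e (bil_form A v a))"
  note inversion = theta_integral_inversion[OF \<tau>, where ?p1.0 = "P$1$1" and ?p2.0 = "P$1$2" and ?p3.0 = "P$2$1" and ?p4.0 = "P$2$2"
        and ?a1.0 = "a$1" and ?a2.0 = "a$2" and ?b1.0 = "\<beta>$1" and ?b2.0 = "\<beta>$2"
        and ?t1.0 = "t_param P c1" and ?t2.0 = "t_param P c2",
      folded \<delta>_def, OF \<delta>, folded f_def]
  have f_g: "f z = ?e (bil_form A a b) * g (V z)" for z
  proof -
    have AV: "A *v V z = int_vec z - \<beta>"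
      by (simp add: V_def \<beta>_def matrix_vector_mult_diff_distrib matrix_inv_mult_vector(1)[OF A])
    define u1 u2 where "u1 = (P *v V z) $ 1" and "u2 = (P *v V z) $ 2"
    \<comment> \<open>Because A = P^t H P with H = \<open>hyp_matrix\<close>, the exchanged dual
      coordinates of the planar formula are exactly those of P (V z).\<close>
    have K: "of_int (fst z) - \<beta>$1 = P$1$1 * u2 + P$2$1 * u1" and L: "of_int (snd z) - \<beta>$2 = P$1$2 * u2 + P$2$2 * u1"
      using arg_cong[OF AV, of "\<lambda>v. v $ 1"] arg_cong[OF AV, of "\<lambda>v. v $ 2"]
      by (simp_all add: mult_vector_2 hyp_form_entries[OF P(2)] u1_def u2_def algebra_simps)
    have "(P$1$1 * (of_int (snd z) - \<beta>$2) - P$1$2 * (of_int (fst z) - \<beta>$1)) = \<delta> * u1"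
      unfolding K L \<delta>_def by algebra
    moreover have "(P$2$2 * (of_int (fst z) - \<beta>$1) - P$2$1 * (of_int (snd z) - \<beta>$2)) = \<delta> * u2"
      unfolding K L \<delta>_def by algebra
    moreover have "of_int (fst z) * a$1 + of_int (snd z) * a$2 = bil_form A a b + bil_form A (V z) a"
    proof -
      have "bil_form A a b + bil_form A a (V z) = a \<bullet> int_vec z"
        unfolding bil_form_def AV \<beta>_def by (simp add: inner_diff_right)
      then show ?thesis
        unfolding bil_form_sym[OF sym, of "V z" a] by (simp add: inner_vec_def sum_2 mult.commute)
    qed
    ultimately have "f z = ?T \<tau> u1 u2 * ?e (bil_form A a b + bil_form A (V z) a)"
      using \<delta> by (simp add: f_def case_prod_unfold del: of_real_add)
    then show ?thesis
      unfolding g_def exp_2pi_i_add u1_def u2_def by (simp only: mult_ac)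
  qed
  have bij_V: "bij_betw V UNIV ((\<lambda>d. d - b) ` dual_lattice A)"
  proof -
    have "inj_on (\<lambda>v. matrix_inv A *v v) int_lattice"
      by (rule inj_on_inverseI[of _ "\<lambda>v. A *v v"]) (rule matrix_inv_mult_vector(1)[OF A])
    then have "bij_betw (\<lambda>v. matrix_inv A *v v) int_lattice (dual_lattice A)"
      by (simp add: bij_betw_def dual_lattice_def)
    moreover have "bij_betw (\<lambda>d. d - b) (dual_lattice A) ((\<lambda>d. d - b) ` dual_lattice A)"
      by (simp add: bij_betw_def inj_on_def)
    ultimately have "bij_betw ((\<lambda>d. d - b) \<circ> ((\<lambda>v. matrix_inv A *v v) \<circ> int_vec)) UNIV ((\<lambda>d. d - b) ` dual_lattice A)"
      using bij_int_vec by (blast intro: bij_betw_trans)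
    then show ?thesis by (simp add: V_def comp_def)
  qed
  have "(\<lambda>z. ?e (bil_form A a b) * g (V z)) summable_on UNIV"
    using inversion(2) by (simp add: f_g[abs_def])
  then have "(\<lambda>z. g (V z)) summable_on UNIV"
    by (subst (asm) summable_on_cmult_right') auto
  then have g_summable: "g summable_on (\<lambda>d. d - b) ` dual_lattice A"
    using summable_on_reindex_bij_betw[OF bij_V, of g] by simp
  have g_sum: "infsum g ((\<lambda>d. d - b) ` dual_lattice A) = (\<Sum>p\<in>R. infsum g ((\<lambda>n. - b + p + n) ` int_lattice))"
  proof -
    have "g summable_on (\<lambda>n. - b + p + n) ` int_lattice" if "p \<in> R" for p
      by (rule summable_on_subset_banach[OF g_summable])
        (use that in \<open>auto simp: dual_lattice_coset_decomposition(1)[OF int A R, of b, symmetric]\<close>)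
    then show ?thesis
      unfolding dual_lattice_coset_decomposition(1)[OF int A R, of b, symmetric]
      by (intro sum_infsum[symmetric] finite_coset_reps[OF int A R] dual_lattice_coset_decomposition(2)[OF int A R])
  qed
  have bij_a: "bij_betw (\<lambda>z. a + int_vec z) UNIV ((\<lambda>n. a + n) ` int_lattice)"
  proof -
    have "bij_betw (\<lambda>n. a + n) int_lattice ((\<lambda>n. a + n) ` int_lattice)"
      by (simp add: bij_betw_def inj_on_def)
    from bij_betw_trans[OF bij_int_vec this] show ?thesis by (simp add: comp_def)
  qed
  have "(\<Sum>\<^sub>\<infinity>v\<in>(\<lambda>n. a + n) ` int_lattice. ?F (- 1 / \<tau>) v * ?e (bil_form A v b)) =
      (\<Sum>\<^sub>\<infinity>z. ?F (- 1 / \<tau>) (a + int_vec z) * ?e (bil_form A (a + int_vec z) b))"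
    by (rule infsum_reindex_bij_betw[OF bij_a, symmetric])
  also have "\<dots> = infsum (\<lambda>(m::int, n::int). ?T (- 1 / \<tau>) (P$1$1 * (of_int m + a$1) + P$1$2 * (of_int n + a$2))
        (P$2$1 * (of_int m + a$1) + P$2$2 * (of_int n + a$2))
        * ?e ((of_int m + a$1) * \<beta>$1 + (of_int n + a$2) * \<beta>$2)) UNIV"
    by (simp add: case_prod_unfold mult_vector_2 bil_form_def inner_vec_def sum_2 \<beta>_def add.commute)
  also have "\<dots> = of_real (norm \<tau> / \<bar>\<delta>\<bar>) * infsum f UNIV"
    by (rule inversion(1))
  also have "infsum f UNIV = ?e (bil_form A a b) * infsum g ((\<lambda>d. d - b) ` dual_lattice A)"
    unfolding f_g infsum_cmult_right' infsum_reindex_bij_betw[OF bij_V] ..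
  finally have main: "(\<Sum>\<^sub>\<infinity>v\<in>(\<lambda>n. a + n) ` int_lattice. ?F (- 1 / \<tau>) v * ?e (bil_form A v b)) =
      of_real (norm \<tau> / \<bar>\<delta>\<bar>) * (?e (bil_form A a b) * (\<Sum>p\<in>R. infsum g ((\<lambda>n. - b + p + n) ` int_lattice)))"
    unfolding g_sum .
  have \<tau>0: "\<tau> \<noteq> 0" using \<tau> by auto
  have "Im (- 1 / \<tau>) = Im \<tau> / (norm \<tau>)\<^sup>2"
    by (simp add: Im_divide cmod_power2)
  then have sq: "sqrt (Im (- 1 / \<tau>)) = sqrt (Im \<tau>) / norm \<tau>"
    by (simp add: real_sqrt_divide)
  have "- det A = \<delta>\<^sup>2"
    unfolding det_hyp_form[OF P(2)] by (simp add: det_2 \<delta>_def)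
  then have "sqrt (- det A) = \<bar>\<delta>\<bar>" by simp
  then show ?thesis
    unfolding Phi_hat_eq_theta_integral[OF P] main sq g_def using \<tau>0
    by (simp add: sum_distrib_left mult_ac)
qed

theorem theorem1:
  fixes A P :: "real^2^2" and C :: "(real^2) set" and c1 c2 :: "real^2"
  assumes "transpose A = A"
    and "\<forall>i j. A $ i $ j \<in> \<int>"
    and "has_signature (quad_form A) 1 1"
    and "C \<in> components {c. quad_form A c = -1}"
    and "invertible P"
    and "A = transpose P ** hyp_matrix ** P"
    and "matrix_inv P *v vector [1, -1] \<in> C"
    and "c1 \<in> C" and "c2 \<in> C"
  shows "\<forall>a b :: real^2.
      (\<forall>l\<in>int_lattice. \<forall>m\<in>dual_lattice A. \<forall>\<tau>. Im \<tau> > 0 \<longrightarrow>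
         Phi_hat A P c1 c2 (a + l) (b + m) \<tau> =
           exp (2 * of_real pi * \<i> * of_real (bil_form A a m)) * Phi_hat A P c1 c2 a b \<tau>) \<and>
      (\<forall>\<tau>. Im \<tau> > 0 \<longrightarrow>
         Phi_hat A P c1 c2 (- a) (- b) \<tau> = Phi_hat A P c1 c2 a b \<tau>) \<and>
      (\<forall>\<tau>. Im \<tau> > 0 \<longrightarrow>
         Phi_hat A P c1 c2 a b (\<tau> + 1) =
           exp (- 2 * of_real pi * \<i> * of_real (quad_form A a)
                - of_real pi * \<i> * of_real (bil_form A (matrix_inv A *v diag_vec A) a)) *
           Phi_hat A P c1 c2 a (a + b + (1/2) *\<^sub>R (matrix_inv A *v diag_vec A)) \<tau>) \<and>
      (\<forall>\<tau> R. Im \<tau> > 0 \<longrightarrow> coset_reps (dual_lattice A) int_lattice R \<longrightarrow>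
         Phi_hat A P c1 c2 a b (- 1 / \<tau>) =
           exp (2 * of_real pi * \<i> * of_real (bil_form A a b)) / of_real (sqrt (- det A)) *
           (\<Sum>p\<in>R. Phi_hat A P c1 c2 (- b + p) a \<tau>))"
proof -
  have A: "invertible A"
    using assms(5) by (simp add: invertible_det_nz det_hyp_form[OF assms(6)])
  show ?thesis
    by (intro allI ballI conjI impI Phi_hat_translate[OF assms(5,6) A] Phi_hat_uminus[OF assms(5,6)]
        Phi_hat_plus_1[OF assms(1,2,5,6) A] Phi_hat_inversion[OF assms(1,2,5,6) A])
qed

end
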